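(* For every positive integer $n$ and every even positive integer $m=2k$, $$N(SO(2n),m)=\binom{n+m/2}{m/2}+\binom{n+m/2-2}{m/2-2}.$$
   Context: $SO(N)$ is the group of real $N\times N$ orthogonal matrices of determinant $1$. $N(G,m)$ denotes the number of conjugacy classes of $G$ (under conjugation by elements of $G$, here $SO(2n)$) contained in $\{x\in G: x^m=1\}$. Binomial coefficients with negative lower index are $0$. *)

theory Defs
  imports "HOL-Algebra.Group_Action" "Jordan_Normal_Form.Determinant"
begin

(* The library constant orthogonal_mat is not the notion needed here: it only asks
   the columns to be nonzero and pairwise orthogonal, not of norm 1. *)
definition special_orthogonal_group :: "nat \<Rightarrow> real mat monoid" where
  "special_orthogonal_group N =
     \<lparr>carrier = {A \<in> carrier_mat N N. transpose_mat A * A = 1\<^sub>m N \<and> det A = 1},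
      monoid.mult = (*), one = 1\<^sub>m N\<rparr>"

lemma special_orthogonal_group_is_group: "group (special_orthogonal_group N)"
proof (rule groupI)
  fix x assume "x \<in> carrier (special_orthogonal_group N)"
  then have x: "x \<in> carrier_mat N N" "transpose_mat x * x = 1\<^sub>m N" "det x = 1"
    by (auto simp: special_orthogonal_group_def)
  then have "x * transpose_mat x = 1\<^sub>m N"
    using mat_mult_left_right_inverse[of "transpose_mat x" N x] by auto
  with x show "\<exists>y\<in>carrier (special_orthogonal_group N).
      y \<otimes>\<^bsub>special_orthogonal_group N\<^esub> x = \<one>\<^bsub>special_orthogonal_group N\<^esub>"
    by (intro bexI[of _ "transpose_mat x"])
      (auto simp: special_orthogonal_group_def det_transpose)
next
  fix x y
  assume "x \<in> carrier (special_orthogonal_group N)" "y \<in> carrier (special_orthogonal_group N)"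
  then have x: "x \<in> carrier_mat N N" "transpose_mat x * x = 1\<^sub>m N" "det x = 1"
    and y: "y \<in> carrier_mat N N" "transpose_mat y * y = 1\<^sub>m N" "det y = 1"
    by (auto simp: special_orthogonal_group_def)
  have "transpose_mat (x * y) * (x * y) = (transpose_mat y * transpose_mat x) * (x * y)"
    using x y by (simp add: transpose_mult[of _ N N])
  also have "\<dots> = transpose_mat y * (transpose_mat x * (x * y))"
    using x y by (intro assoc_mult_mat[of _ N N _ N _ N]) auto
  also have "transpose_mat x * (x * y) = (transpose_mat x * x) * y"
    using x y by (intro assoc_mult_mat[of _ N N _ N _ N, symmetric]) auto
  finally have "transpose_mat (x * y) * (x * y) = 1\<^sub>m N"
    using x y by simp
  then show "x \<otimes>\<^bsub>special_orthogonal_group N\<^esub> y \<in> carrier (special_orthogonal_group N)"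
    using x y by (auto simp: special_orthogonal_group_def det_mult[of _ N])
qed (auto simp: special_orthogonal_group_def assoc_mult_mat[of _ N N _ N _ N])

definition conjugacy_classes :: "('a, 'b) monoid_scheme \<Rightarrow> 'a set set" where
  "conjugacy_classes G =
     orbits G (carrier G) (\<lambda>g. \<lambda>x \<in> carrier G. g \<otimes>\<^bsub>G\<^esub> x \<otimes>\<^bsub>G\<^esub> inv\<^bsub>G\<^esub> g)"

definition num_conjugacy_classes_exponent :: "('a, 'b) monoid_scheme \<Rightarrow> nat \<Rightarrow> nat" where
  "num_conjugacy_classes_exponent G m =
     card {C \<in> conjugacy_classes G. C \<subseteq> {x \<in> carrier G. x [^]\<^bsub>G\<^esub> m = \<one>\<^bsub>G\<^esub>}}"

definition binomial_int :: "nat \<Rightarrow> int \<Rightarrow> nat" where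
  "binomial_int a b = (if b < 0 then 0 else a choose nat b)"

end

theory Submission
  imports Defs
begin

text \<open>
  With \<open>m = 2k\<close>, an element of \<open>SO(2n)\<close> killed by \<open>m\<close> is a sum of \<open>n\<close> plane rotations by angles
  \<open>\<pi> j / k\<close> with \<open>0 \<le> j \<le> k\<close>: discrete Fourier coefficients of orbits supply the
  eigenplanes, and the determinant forbids an unpaired \<open>-1\<close>. The characteristic polynomial recovers
  the multiset of the \<open>j\<close>. The orthonormal frame may be taken of determinant \<open>1\<close>, after reversing
  a vector, at the price of negating one angle; this is harmless if some \<open>j\<close> is \<open>0\<close> or \<open>k\<close>.
  Otherwise the two signs are not conjugate, because the centralizer consists of complex linear maps,
  whose real determinant is not negative. Hence the classes correspond to the multisets of size \<open>n\<close>
  in \<open>{0..k}\<close> together with a second copy of those in \<open>{1..<k}\<close>.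
\<close>

section \<open>Block matrices and rotations\<close>

text \<open>Coordinates list the first vectors of all planes before the second ones. A sum of plane
  rotations is then a matrix of four diagonal blocks, so products and determinants are computed
  index by index, and the complex structure exchanges the two halves up to sign. Eigenplanes are
  built inside the reals. The delicate angles are \<open>0\<close> and \<open>pi\<close>: there a
  Fourier coefficient gives only an eigenvector, and a second one with the same eigenvalue has to be
  found. Conjugacy is handled as an intertwining relation \<open>x * g = g * y\<close>, without
  inverses. In the count, \<open>k + 1\<close> symbols give (n + k choose n) multisets of size n and
  the \<open>k - 1\<close> inner symbols give (n + k - 2 choose n); symmetry of binomial
  coefficients turns these into the two terms of the formula.\<close>

definition diag_block :: "nat \<Rightarrow> (nat \<Rightarrow> 'a) \<Rightarrow> (nat \<Rightarrow> 'a) \<Rightarrow> (nat \<Rightarrow> 'a) \<Rightarrow> (nat \<Rightarrow> 'a) \<Rightarrow> 'a :: comm_ring_1 mat" where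
  "diag_block n a b c d = four_block_mat (mat_diag n a) (mat_diag n b) (mat_diag n c) (mat_diag n d)"

lemma diag_block_carrier [simp]: "diag_block n a b c d \<in> carrier_mat (2 * n) (2 * n)"
  unfolding diag_block_def mult_2 by (intro four_block_carrier_mat mat_diag_dim)

lemma diag_block_dim [simp]:
  "dim_row (diag_block n a b c d) = 2 * n" "dim_col (diag_block n a b c d) = 2 * n"
  using diag_block_carrier[of n a b c d] by (auto simp del: diag_block_carrier)

lemma diag_block_index:
  "x < n \<Longrightarrow> y < n \<Longrightarrow> diag_block n a b c d $$ (x, y) = (if x = y then a x else 0)"
  "x < n \<Longrightarrow> y < n \<Longrightarrow> diag_block n a b c d $$ (x, n + y) = (if x = y then b x else 0)"
  "x < n \<Longrightarrow> y < n \<Longrightarrow> diag_block n a b c d $$ (n + x, y) = (if x = y then c x else 0)"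
  "x < n \<Longrightarrow> y < n \<Longrightarrow> diag_block n a b c d $$ (n + x, n + y) = (if x = y then d x else 0)"
  by (auto simp: diag_block_def mat_diag_def)

lemma eq_mat_blockI:
  assumes "A \<in> carrier_mat (2 * n) (2 * n)" "B \<in> carrier_mat (2 * n) (2 * n)"
    and "\<And>x y. x < n \<Longrightarrow> y < n \<Longrightarrow> A $$ (x, y) = B $$ (x, y)"
    and "\<And>x y. x < n \<Longrightarrow> y < n \<Longrightarrow> A $$ (x, n + y) = B $$ (x, n + y)"
    and "\<And>x y. x < n \<Longrightarrow> y < n \<Longrightarrow> A $$ (n + x, y) = B $$ (n + x, y)"
    and "\<And>x y. x < n \<Longrightarrow> y < n \<Longrightarrow> A $$ (n + x, n + y) = B $$ (n + x, n + y)"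
  shows "A = B"
proof (rule eq_matI)
  fix i j assume "i < dim_row B" "j < dim_col B"
  then have ij: "i < 2 * n" "j < 2 * n" using assms by auto
  then consider "i < n" "j < n" | y where "i < n" "y < n" "j = n + y" | x where "x < n" "i = n + x" "j < n"
    | x y where "x < n" "i = n + x" "y < n" "j = n + y"
    by (metis add_diff_inverse_nat mult_2 nat_add_left_cancel_less)
  then show "A $$ (i, j) = B $$ (i, j)" by cases (use assms in auto)
qed (use assms in auto)

lemma diag_block_mult:
  "diag_block n a b c d * diag_block n a' b' c' d' =
    diag_block n (\<lambda>i. a i * a' i + b i * c' i) (\<lambda>i. a i * b' i + b i * d' i)
      (\<lambda>i. c i * a' i + d i * c' i) (\<lambda>i. c i * b' i + d i * d' i)"
proof -
  have add: "mat_diag n f + mat_diag n g = mat_diag n (\<lambda>i. f i + g i)" for f g :: "nat \<Rightarrow> 'a"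
    by (rule eq_matI) (auto simp: mat_diag_def)
  show ?thesis unfolding diag_block_def
    by (subst mult_four_block_mat[of _ n n _ n _ n _ _ n _ n]) (auto simp: add)
qed

lemma diag_block_one: "diag_block n (\<lambda>_. 1) (\<lambda>_. 0) (\<lambda>_. 0) (\<lambda>_. 1) = 1\<^sub>m (2 * n)"
  by (rule eq_mat_blockI) (auto simp: diag_block_index)

lemma diag_block_transpose: "transpose_mat (diag_block n a b c d) = diag_block n a c b d"
  by (rule eq_mat_blockI) (auto simp: diag_block_index)

lemma det_mat_diag: "det (mat_diag n f) = (\<Prod>i<n. f i)"
proof -
  have "upper_triangular (mat_diag n f)" by (auto simp: mat_diag_def)
  then have "det (mat_diag n f) = prod_list (diag_mat (mat_diag n f))"
    by (rule det_upper_triangular[OF _ mat_diag_dim])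
  also have "diag_mat (mat_diag n f) = map f [0..<n]"
    by (auto simp: diag_mat_def mat_diag_def)
  finally show ?thesis
    by (simp add: atLeast0LessThan flip: prod.distinct_set_conv_list)
qed

text \<open>Diagonal blocks commute, which is the condition of the determinant formula for four
  blocks; the combined block is diagonal again.\<close>

lemma det_diag_block:
  fixes a :: "nat \<Rightarrow> 'a :: idom"
  shows "det (diag_block n a b c d) = (\<Prod>i<n. a i * d i - b i * c i)"
proof -
  have "det (diag_block n a b c d) = det (mat_diag n a * mat_diag n d - mat_diag n b * mat_diag n c)"
    unfolding diag_block_def
    by (rule det_four_block_mat[OF mat_diag_dim mat_diag_dim mat_diag_dim mat_diag_dim])
      (simp add: mult.commute)
  also have "mat_diag n a * mat_diag n d - mat_diag n b * mat_diag n c = mat_diag n (\<lambda>i. a i * d i - b i * c i)"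
    unfolding mat_diag_diag by (rule eq_matI) (auto simp: mat_diag_def)
  finally show ?thesis by (simp add: det_mat_diag)
qed

definition rotation_mat :: "nat \<Rightarrow> (nat \<Rightarrow> real) \<Rightarrow> real mat" where
  "rotation_mat n t = diag_block n (\<lambda>i. cos (t i)) (\<lambda>i. - sin (t i)) (\<lambda>i. sin (t i)) (\<lambda>i. cos (t i))"

lemma rotation_mat_carrier [simp]: "rotation_mat n t \<in> carrier_mat (2 * n) (2 * n)"
  by (simp add: rotation_mat_def)

lemma rotation_mat_mult: "rotation_mat n s * rotation_mat n t = rotation_mat n (\<lambda>i. s i + t i)"
  unfolding rotation_mat_def diag_block_mult
  by (intro arg_cong4[where f = "diag_block n"]) (auto simp: cos_add sin_add algebra_simps)

lemma rotation_mat_transpose: "transpose_mat (rotation_mat n t) = rotation_mat n (\<lambda>i. - t i)"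
  by (simp add: rotation_mat_def diag_block_transpose)

lemma rotation_mat_eq_one:
  assumes "\<And>i. i < n \<Longrightarrow> cos (t i) = 1"
  shows "rotation_mat n t = 1\<^sub>m (2 * n)"
  unfolding diag_block_one[symmetric] rotation_mat_def
  by (rule eq_mat_blockI) (auto simp: diag_block_index assms cos_one_sin_zero)

lemma rotation_mat_pow: "rotation_mat n t ^\<^sub>m l = rotation_mat n (\<lambda>i. l * t i)"
proof (induction l)
  case 0
  have "dim_row (rotation_mat n t) = 2 * n"
    by (metis carrier_matD(1) rotation_mat_carrier)
  then show ?case by (simp add: rotation_mat_eq_one)
qed (simp add: rotation_mat_mult algebra_simps)

lemma det_rotation_mat: "det (rotation_mat n t) = 1"
  by (simp add: rotation_mat_def det_diag_block flip: power2_eq_square)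

text \<open>Only cosines survive, so the characteristic polynomial cannot tell an angle from its
  negative. A second invariant is needed to separate the two copies of a class.\<close>

lemma det_char_rotation_mat:
  "det (x \<cdot>\<^sub>m 1\<^sub>m (2 * n) - rotation_mat n t) = (\<Prod>i<n. x\<^sup>2 - 2 * cos (t i) * x + 1)"
proof -
  have "x \<cdot>\<^sub>m 1\<^sub>m (2 * n) - rotation_mat n t =
    diag_block n (\<lambda>i. x - cos (t i)) (\<lambda>i. sin (t i)) (\<lambda>i. - sin (t i)) (\<lambda>i. x - cos (t i))"
    by (rule eq_mat_blockI) (auto simp: diag_block_index rotation_mat_def)
  also have "det \<dots> = (\<Prod>i<n. x\<^sup>2 - 2 * cos (t i) * x + 1)"
    unfolding det_diag_block
  proof (intro prod.cong refl)
    fix i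
    show "(x - cos (t i)) * (x - cos (t i)) - sin (t i) * - sin (t i) = x\<^sup>2 - 2 * cos (t i) * x + 1"
      using sin_cos_squared_add[of "t i"] by (simp add: power2_eq_square algebra_simps)
  qed
  finally show ?thesis .
qed

section \<open>Orthonormal frames\<close>

text \<open>The number \<open>r\<close> of pairs is independent of the dimension \<open>N\<close>
  because the frame is built one plane at a time.\<close>

definition orthonormal_pairs :: "nat \<Rightarrow> nat \<Rightarrow> (nat \<Rightarrow> real vec) \<Rightarrow> (nat \<Rightarrow> real vec) \<Rightarrow> bool" where
  "orthonormal_pairs N r u v \<longleftrightarrow>
    (\<forall>i<r. u i \<in> carrier_vec N \<and> v i \<in> carrier_vec N) \<and>
    (\<forall>i<r. \<forall>j<r. u i \<bullet> u j = of_bool (i = j) \<and> v i \<bullet> v j = of_bool (i = j) \<and> u i \<bullet> v j = 0)"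

definition perp :: "nat \<Rightarrow> nat \<Rightarrow> (nat \<Rightarrow> real vec) \<Rightarrow> (nat \<Rightarrow> real vec) \<Rightarrow> real vec \<Rightarrow> bool" where
  "perp N r u v w \<longleftrightarrow> w \<in> carrier_vec N \<and> (\<forall>i<r. u i \<bullet> w = 0 \<and> v i \<bullet> w = 0)"

lemma orthonormal_pairs_extend:
  assumes "orthonormal_pairs N r u v" "perp N r u v p" "perp N r u v q"
    and "p \<bullet> p = 1" "q \<bullet> q = 1" "p \<bullet> q = 0"
  shows "orthonormal_pairs N (Suc r) (u(r := p)) (v(r := q))"
proof -
  have pu: "x \<bullet> u i = 0 \<and> x \<bullet> v i = 0" if "i < r" "perp N r u v x" for i x
    using comm_scalar_prod[of x N "u i"] comm_scalar_prod[of x N "v i"] assms(1) that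
    by (auto simp: orthonormal_pairs_def perp_def)
  show ?thesis
    using assms pu[OF _ assms(2)] pu[OF _ assms(3)] unfolding orthonormal_pairs_def perp_def by (auto simp: less_Suc_eq)
qed

definition pair_mat :: "nat \<Rightarrow> (nat \<Rightarrow> real vec) \<Rightarrow> (nat \<Rightarrow> real vec) \<Rightarrow> real mat" where
  "pair_mat n u v = mat (2 * n) (2 * n) (\<lambda>(a, b). if b < n then u b $ a else v (b - n) $ a)"

lemma pair_mat_carrier [simp]: "pair_mat n u v \<in> carrier_mat (2 * n) (2 * n)"
  by (simp add: pair_mat_def)

lemma pair_mat_dim [simp]: "dim_row (pair_mat n u v) = 2 * n" "dim_col (pair_mat n u v) = 2 * n"
  by (simp_all add: pair_mat_def)

lemma col_pair_mat:
  assumes "orthonormal_pairs (2 * n) n u v" "i < n"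
  shows "col (pair_mat n u v) i = u i" "col (pair_mat n u v) (n + i) = v i"
  using assms by (auto simp: pair_mat_def orthonormal_pairs_def intro!: eq_vecI)

lemma pair_mat_orthogonal:
  assumes "orthonormal_pairs (2 * n) n u v"
  shows "transpose_mat (pair_mat n u v) * pair_mat n u v = 1\<^sub>m (2 * n)"
proof -
  have "v i \<bullet> u j = 0" if "i < n" "j < n" for i j
    using comm_scalar_prod[of "v i" "2 * n" "u j"] assms that by (auto simp: orthonormal_pairs_def)
  then show ?thesis
    using assms
    by (intro eq_mat_blockI[of _ n]) (auto simp: carrier_matI col_pair_mat[OF assms] orthonormal_pairs_def)
qed

text \<open>For an orthonormal frame \<open>Q\<close> the entries of the transpose of
  \<open>Q\<close> times \<open>M * Q\<close> are scalar products of frame vectors with their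
  images. Multiplying by \<open>Q\<close> on the left then removes the transpose.\<close>

lemma pair_mat_conj:
  assumes M: "M \<in> carrier_mat (2 * n) (2 * n)" and on: "orthonormal_pairs (2 * n) n u v"
    and Mu: "\<And>i. i < n \<Longrightarrow> M *\<^sub>v u i = a i \<cdot>\<^sub>v u i + c i \<cdot>\<^sub>v v i"
    and Mv: "\<And>i. i < n \<Longrightarrow> M *\<^sub>v v i = b i \<cdot>\<^sub>v u i + d i \<cdot>\<^sub>v v i"
  shows "M * pair_mat n u v = pair_mat n u v * diag_block n a b c d"
proof -
  let ?Q = "pair_mat n u v"
  have c: "u i \<in> carrier_vec (2*n)" "v i \<in> carrier_vec (2*n)" if "i < n" for i
    using on that by (auto simp: orthonormal_pairs_def)
  have vu: "v i \<bullet> u j = 0" if "i < n" "j < n" for i j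
    using comm_scalar_prod[of "v i" "2 * n" "u j"] on that by (auto simp: orthonormal_pairs_def)
  have idx: "(transpose_mat ?Q * (M * ?Q)) $$ (i, j) = col ?Q i \<bullet> (M *\<^sub>v col ?Q j)"
    if "i < 2 * n" "j < 2 * n" for i j
    using M that by (simp add: col_mult2[OF M pair_mat_carrier])
  have "transpose_mat ?Q * (M * ?Q) = diag_block n a b c d"
  proof (rule eq_mat_blockI[of _ n])
    have sp: "x \<bullet> (\<alpha> \<cdot>\<^sub>v u i + \<beta> \<cdot>\<^sub>v v i) = \<alpha> * (x \<bullet> u i) + \<beta> * (x \<bullet> v i)"
      if "i < n" "x \<in> carrier_vec (2 * n)" for x \<alpha> \<beta> i
      using that c by (subst scalar_prod_add_distrib[of _ "2 * n"]) auto
    fix x y assume "x < n" "y < n"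
    then show "(transpose_mat ?Q * (M * ?Q)) $$ (x, y) = diag_block n a b c d $$ (x, y)"
      "(transpose_mat ?Q * (M * ?Q)) $$ (x, n + y) = diag_block n a b c d $$ (x, n + y)"
      "(transpose_mat ?Q * (M * ?Q)) $$ (n + x, y) = diag_block n a b c d $$ (n + x, y)"
      "(transpose_mat ?Q * (M * ?Q)) $$ (n + x, n + y) = diag_block n a b c d $$ (n + x, n + y)"
      using on
      by (simp_all add: idx col_pair_mat[OF on] Mu Mv sp c vu diag_block_index orthonormal_pairs_def
          del: index_mult_mat)
  qed (use M in auto)
  moreover have inv: "?Q * transpose_mat ?Q = 1\<^sub>m (2 * n)"
    using mat_mult_left_right_inverse[OF _ _ pair_mat_orthogonal[OF on]] by auto
  ultimately have "(?Q * transpose_mat ?Q) * (M * ?Q) = ?Q * diag_block n a b c d"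
    using M by (subst assoc_mult_mat[of _ "2*n" "2*n" _ "2*n" _ "2*n"]) auto
  with inv M show ?thesis by auto
qed

text \<open>Padding the family with zero rows gives a square matrix whose last row is zero. Its
  transpose kills the last unit vector, so the determinant vanishes and the matrix itself has a
  nonzero kernel vector.\<close>

lemma exists_perp_list:
  fixes F :: "'a :: field vec list"
  assumes F: "length F < N" "set F \<subseteq> carrier_vec N"
  shows "\<exists>w\<in>carrier_vec N. w \<noteq> 0\<^sub>v N \<and> (\<forall>f\<in>set F. f \<bullet> w = 0)"
proof -
  define A where "A = mat_of_rows N (F @ replicate (N - length F) (0\<^sub>v N))"
  have A: "A \<in> carrier_mat N N" using F by (auto simp: A_def)
  have r: "row A i = (F @ replicate (N - length F) (0\<^sub>v N)) ! i" if "i < N" for i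
    unfolding A_def by (rule mat_of_rows_row) (use F that in \<open>auto simp: nth_append\<close>)
  have "transpose_mat A *\<^sub>v unit_vec N (N - 1) = row A (N - 1)"
    using A F by (intro eq_vecI) auto
  also have "\<dots> = 0\<^sub>v N"
    using F by (auto simp: r nth_append)
  finally have z: "transpose_mat A *\<^sub>v unit_vec N (N - 1) = 0\<^sub>v N" .
  have nz: "unit_vec N (N - 1) \<noteq> (0\<^sub>v N :: 'a vec)"
  proof
    assume "unit_vec N (N - 1) = (0\<^sub>v N :: 'a vec)"
    then have "unit_vec N (N - 1) $ (N - 1) = (0\<^sub>v N :: 'a vec) $ (N - 1)" by simp
    with F show False by simp
  qed
  have "transpose_mat A \<in> carrier_mat N N" using A by simp
  from det_0_iff_vec_prod_zero[OF this] z nz have "det (transpose_mat A) = 0"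
    using unit_vec_carrier[of N "N - 1"] by blast
  then have "det A = 0" by (simp add: det_transpose[OF A])
  then have "\<exists>w. w \<in> carrier_vec N \<and> w \<noteq> 0\<^sub>v N \<and> A *\<^sub>v w = 0\<^sub>v N"
    by (rule iffD1[OF det_0_iff_vec_prod_zero[OF A]])
  then obtain w where w: "w \<in> carrier_vec N" "w \<noteq> 0\<^sub>v N" "A *\<^sub>v w = 0\<^sub>v N"
    by blast
  have "f \<bullet> w = 0" if f: "f \<in> set F" for f
  proof -
    obtain i where i: "i < length F" "f = F ! i" using f unfolding in_set_conv_nth by blast
    have "f \<bullet> w = (A *\<^sub>v w) $ i"
      using i F A by (simp add: r nth_append)
    then show ?thesis using w i F by simp
  qed
  with w show ?thesis by blast
qed

lemma exists_perp:
  assumes on: "orthonormal_pairs N r u v" and F: "set F \<subseteq> carrier_vec N" "2 * r + length F < N"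
  obtains w where "perp N r u v w" "w \<noteq> 0\<^sub>v N" "\<And>f. f \<in> set F \<Longrightarrow> f \<bullet> w = 0"
proof -
  let ?L = "map u [0..<r] @ map v [0..<r] @ F"
  have "set ?L \<subseteq> carrier_vec N" "length ?L < N"
    using on F by (auto simp: orthonormal_pairs_def)
  then obtain w where "w \<in> carrier_vec N" "w \<noteq> 0\<^sub>v N" "\<forall>f\<in>set ?L. f \<bullet> w = 0"
    using exists_perp_list[of ?L N] by blast
  then show thesis by (intro that[of w]) (auto simp: perp_def)
qed

section \<open>Eigenplanes of isometries of finite order\<close>

text \<open>Real part of the geometric sum over the powers of an \<open>m\<close>-th root of unity,
  which differs from 1 because \<open>m\<close> does not divide \<open>l\<close>.\<close>

lemma sum_cos_multiples_eq_0:
  assumes "0 < l" "l < m"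
  shows "(\<Sum>j<m. cos (2 * pi * real j * real l / real m)) = 0"
proof -
  define z where "z = cis (2 * pi * real l / real m)"
  have zj: "z ^ j = cis (2 * pi * real j * real l / real m)" for j
    unfolding z_def DeMoivre by (simp add: algebra_simps)
  have "z \<noteq> 1"
  proof
    assume "z = 1"
    then have "cos (2 * pi * real l / real m) = 1" by (simp add: z_def complex_eq_iff)
    then obtain k :: int where "2 * pi * real l / real m = of_int k * 2 * pi"
      unfolding cos_one_2pi_int by blast
    then have "real l = of_int k * real m" using assms by (simp add: field_simps)
    then have "real_of_int (int l) = of_int (k * int m)" by simp
    then have *: "int l = k * int m" unfolding of_int_eq_iff .
    have "k > 0"
    proof (rule ccontr)
      assume "\<not> k > 0"
      then have "k * int m \<le> 0" by (intro mult_nonpos_nonneg) auto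
      with * assms show False by simp
    qed
    then have "1 * int m \<le> k * int m" by (intro mult_right_mono) auto
    with * assms show False by simp
  qed
  moreover have "z ^ m = 1"
  proof -
    have "2 * pi * real m * real l / real m = 2 * real l * pi" using assms by simp
    then show ?thesis unfolding zj by (simp only:) (simp add: complex_eq_iff cos_2npi sin_2npi del: mult.assoc)
  qed
  ultimately have "(\<Sum>j<m. z ^ j) = 0" by (simp add: sum_gp_strict)
  then have "Re (\<Sum>j<m. z ^ j) = 0" by simp
  then show ?thesis by (simp add: zj)
qed

text \<open>The linear recurrence of cosines in arithmetic progression; it becomes the quadratic
  relation between \<open>M\<close> and the Fourier coefficients of an orbit.\<close>

lemma cos_add_sub_recurrence: "cos (x + 2 * t) - 2 * cos t * cos (x + t) + cos x = (0::real)"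
proof -
  have "cos (x + 2 * t) + cos x = 2 * cos (x + t) * cos t"
    using cos_plus_cos[of "x + 2 * t" x] by (simp add: algebra_simps add_divide_distrib)
  then show ?thesis by (simp add: mult_ac)
qed

lemma sum_periodic_shift:
  fixes h :: "nat \<Rightarrow> 'a :: comm_monoid_add"
  assumes "h m = h 0"
  shows "(\<Sum>l<m. h (Suc l)) = (\<Sum>l<m. h l)"
proof (cases m)
  case (Suc k)
  have "(\<Sum>l<m. h (Suc l)) = (\<Sum>l<k. h (Suc l)) + h m" by (simp add: Suc)
  also have "\<dots> = h 0 + (\<Sum>l<k. h (Suc l))" by (simp add: assms add.commute)
  also have "\<dots> = (\<Sum>l<m. h l)" unfolding Suc by (rule sum.lessThan_Suc_shift[symmetric])
  finally show ?thesis .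
qed simp

text \<open>The dimension is explicit because the zero vector depends on it, so a sum of vectors has
  no uniform neutral element.\<close>

definition vec_sum :: "nat \<Rightarrow> nat \<Rightarrow> (nat \<Rightarrow> 'a) \<Rightarrow> (nat \<Rightarrow> 'a vec) \<Rightarrow> 'a :: comm_ring_1 vec" where
  "vec_sum N m a f = vec N (\<lambda>i. \<Sum>l<m. a l * f l $ i)"

lemma vec_sum_carrier [simp]: "vec_sum N m a f \<in> carrier_vec N"
  by (simp add: vec_sum_def)

lemma scalar_prod_vec_sum:
  assumes "\<And>l. f l \<in> carrier_vec N"
  shows "x \<bullet> vec_sum N m a f = (\<Sum>l<m. a l * (x \<bullet> f l))"
proof -
  have "x \<bullet> vec_sum N m a f = (\<Sum>i<N. \<Sum>l<m. a l * (x $ i * f l $ i))"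
    by (simp add: scalar_prod_def vec_sum_def sum_distrib_left atLeast0LessThan algebra_simps)
  also have "\<dots> = (\<Sum>l<m. a l * (\<Sum>i<N. x $ i * f l $ i))"
    by (subst sum.swap) (simp add: sum_distrib_left)
  also have "\<dots> = (\<Sum>l<m. a l * (x \<bullet> f l))"
    using assms by (simp add: scalar_prod_def atLeast0LessThan carrier_vecD[OF assms])
  finally show ?thesis .
qed

lemma mat_mult_vec_sum:
  assumes "M \<in> carrier_mat N N" "\<And>l. f l \<in> carrier_vec N"
  shows "M *\<^sub>v vec_sum N m a f = vec_sum N m a (\<lambda>l. M *\<^sub>v f l)"
proof (rule eq_vecI)
  fix i assume "i < dim_vec (vec_sum N m a (\<lambda>l. M *\<^sub>v f l))"
  then have "i < N" by (simp add: vec_sum_def)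
  then show "(M *\<^sub>v vec_sum N m a f) $ i = vec_sum N m a (\<lambda>l. M *\<^sub>v f l) $ i"
    using assms(1) by (simp add: scalar_prod_vec_sum[OF assms(2)]) (simp add: vec_sum_def)
qed (use assms(1) in \<open>simp add: vec_sum_def\<close>)

text \<open>The \<open>2 * k\<close>-th roots of unity have arguments
  \<open>2 * pi * j / (2 * k)\<close>; up to sign, \<open>j\<close> from 0 to \<open>k\<close>
  covers them all.\<close>

definition angle :: "nat \<Rightarrow> nat \<Rightarrow> real" where "angle k j = pi * real j / real k"

locale finite_order_isometry =
  fixes N k :: nat and M :: "real mat"
  assumes M: "M \<in> carrier_mat N N" and orthogonal: "transpose_mat M * M = 1\<^sub>m N"
    and k: "k > 0" and order: "M ^\<^sub>m (2 * k) = 1\<^sub>m N"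
begin



lemma mult_M [simp]: "x \<in> carrier_vec N \<Longrightarrow> M *\<^sub>v x \<in> carrier_vec N"
  using M by simp

lemma isometry:
  assumes "x \<in> carrier_vec N" "y \<in> carrier_vec N"
  shows "(M *\<^sub>v x) \<bullet> (M *\<^sub>v y) = x \<bullet> y"
proof -
  have "(M *\<^sub>v x) \<bullet> (M *\<^sub>v y) = (transpose_mat M *\<^sub>v (M *\<^sub>v x)) \<bullet> y"
    using assms M by (simp add: transpose_vec_mult_scalar)
  also have "transpose_mat M *\<^sub>v (M *\<^sub>v x) = x"
    using assms M orthogonal by (simp flip: assoc_mult_mat_vec)
  finally show ?thesis .
qed

text \<open>Matrix powers put the new factor on the right; stepping along an orbit needs it on the
  left.\<close>

lemma pow_Suc_mult_vec:
  assumes "w \<in> carrier_vec N"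
  shows "M ^\<^sub>m Suc l *\<^sub>v w = M *\<^sub>v (M ^\<^sub>m l *\<^sub>v w)"
proof -
  have "M ^\<^sub>m Suc l = M * M ^\<^sub>m l"
    using M by (induction l) (auto simp: assoc_mult_mat[of _ N N _ N _ N])
  then show ?thesis using M assms by (simp add: assoc_mult_mat_vec[of _ N N _ N])
qed

text \<open>The Fourier coefficients of the cyclic orbit of \<open>w\<close> add up to a nonzero multiple of \<open>w\<close>,
  so one of them does not vanish.\<close>

lemma exists_isotypic_vector:
  assumes w: "w \<in> carrier_vec N" "w \<noteq> 0\<^sub>v N"
  obtains p j where "p \<in> carrier_vec N" "p \<noteq> 0\<^sub>v N" "j \<le> k"
    "M *\<^sub>v (M *\<^sub>v p) = 2 * cos (angle k j) \<cdot>\<^sub>v (M *\<^sub>v p) - p"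
    "\<And>x. x \<in> carrier_vec N \<Longrightarrow> (\<And>l. x \<bullet> (M ^\<^sub>m l *\<^sub>v w) = 0) \<Longrightarrow> x \<bullet> p = 0"
proof -
  define f where "f l = M ^\<^sub>m l *\<^sub>v w" for l
  have fc [simp]: "f l \<in> carrier_vec N" for l
    using M w unfolding f_def by (intro mult_mat_vec_carrier[OF pow_carrier_mat])
  have fS: "M *\<^sub>v f l = f (Suc l)" for l
    unfolding f_def by (rule pow_Suc_mult_vec[OF w(1), symmetric])
  have per: "f (2 * k + l) = f l" for l
  proof (induction l)
    case 0
    then show ?case using M w by (simp add: f_def order)
  next
    case (Suc l)
    then show ?case using fS[of "2 * k + l"] fS[of l] by simp
  qed
  \<comment> \<open>Real Fourier weights. Up to a positive factor, \<open>p j\<close> below is the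
    component of \<open>w\<close> on which \<open>M\<close> has the eigenvalues \<open>cis\<close>
    of plus and minus \<open>angle k j\<close>.\<close>
  define c where "c j l = cos (angle k j * real l)" for j l
  have cper: "c j (2 * k + l) = c j l" for j l
  proof -
    have "angle k j * real (2 * k + l) = angle k j * real l + 2 * real j * pi"
      using k by (simp add: angle_def field_simps)
    then show ?thesis
      unfolding c_def by (simp add: cos_add cos_2npi sin_2npi del: of_nat_add of_nat_mult)
  qed
  define p where "p j = vec_sum N (2 * k) (c j) f" for j
  have rec: "M *\<^sub>v (M *\<^sub>v p j) = 2 * cos (angle k j) \<cdot>\<^sub>v (M *\<^sub>v p j) - p j" for j
  proof (rule eq_vecI)
    fix i assume "i < dim_vec (2 * cos (angle k j) \<cdot>\<^sub>v (M *\<^sub>v p j) - p j)"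
    then have i: "i < N" by (simp add: p_def vec_sum_def)
    let ?S = "\<lambda>g. \<Sum>l<2*k. g l"
    \<comment> \<open>Cyclic shifts bring all three sums to the common vector
      \<open>f (l + 2)\<close>; the weights then stand at three consecutive places and cancel by the
      cosine recurrence.\<close>
    have 1: "?S (\<lambda>l. c j l * f l $ i) = ?S (\<lambda>l. c j (l + 2) * f (l + 2) $ i)"
      using sum_periodic_shift[of "\<lambda>l. c j l * f l $ i" "2 * k"]
        sum_periodic_shift[of "\<lambda>l. c j (l + 1) * f (l + 1) $ i" "2 * k"]
        per[of 0] per[of 1] cper[of j 0] cper[of j 1] by simp
    have 2: "?S (\<lambda>l. c j l * f (l + 1) $ i) = ?S (\<lambda>l. c j (l + 1) * f (l + 2) $ i)"
      using sum_periodic_shift[of "\<lambda>l. c j l * f (l + 1) $ i" "2 * k"]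
        per[of 0] per[of 1] cper[of j 0] by simp
    have "?S (\<lambda>l. c j l * f (l + 2) $ i) - 2 * cos (angle k j) * ?S (\<lambda>l. c j l * f (l + 1) $ i)
        + ?S (\<lambda>l. c j l * f l $ i) =
      ?S (\<lambda>l. (c j (l + 2) - 2 * cos (angle k j) * c j (l + 1) + c j l) * f (l + 2) $ i)"
      unfolding 1 2 by (simp add: algebra_simps sum.distrib sum_subtractf sum_distrib_left)
    also have "\<dots> = 0"
    proof (rule sum.neutral, rule ballI)
      fix l
      have "c j (l + 2) - 2 * cos (angle k j) * c j (l + 1) + c j l = 0"
        using cos_add_sub_recurrence[of "angle k j * real l" "angle k j"]
        by (simp add: c_def algebra_simps)
      then show "(c j (l + 2) - 2 * cos (angle k j) * c j (l + 1) + c j l) * f (l + 2) $ i = 0" by simp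
    qed
    finally show "(M *\<^sub>v (M *\<^sub>v p j)) $ i = (2 * cos (angle k j) \<cdot>\<^sub>v (M *\<^sub>v p j) - p j) $ i"
      using i unfolding p_def
      by (simp add: mat_mult_vec_sum[OF M] fS del: index_mult_mat_vec) (simp add: vec_sum_def)
  qed (use M in \<open>auto simp: p_def vec_sum_def\<close>)
  have "\<exists>j<2*k. p j \<noteq> 0\<^sub>v N"
  proof (rule ccontr)
    assume "\<not> ?thesis"
    then have 0: "p j $ i = 0" if "j < 2 * k" "i < N" for i j using that by auto
    have "w $ i = 0" if i: "i < N" for i
    proof -
      have "0 = (\<Sum>j<2*k. \<Sum>l<2*k. c j l * f l $ i)"
        using 0 i by (simp add: p_def vec_sum_def)
      also have "\<dots> = (\<Sum>l<2*k. (\<Sum>j<2*k. c j l) * f l $ i)"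
        by (subst sum.swap) (simp add: sum_distrib_right)
      also have "\<dots> = (\<Sum>l\<in>{0}. (\<Sum>j<2*k. c j l) * f l $ i)"
      proof (rule sum.mono_neutral_right)
        show "\<forall>l\<in>{..<2*k} - {0}. (\<Sum>j<2*k. c j l) * f l $ i = 0"
        proof
          fix l assume "l \<in> {..<2*k} - {0}"
          then have "(\<Sum>j<2*k. cos (2 * pi * real j * real l / real (2 * k))) = 0"
            by (intro sum_cos_multiples_eq_0) auto
          then show "(\<Sum>j<2*k. c j l) * f l $ i = 0" by (simp add: c_def angle_def mult.assoc)
        qed
      qed (use k in auto)
      also have "\<dots> = 2 * k * w $ i" using M w by (simp add: c_def f_def)
      finally show ?thesis using k by simp
    qed
    with w show False by auto
  qed
  then obtain j where j: "j < 2 * k" "p j \<noteq> 0\<^sub>v N" by blast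
  \<comment> \<open>Indices above \<open>k\<close> are folded back by replacing the angle
    \<open>t\<close> by \<open>2 * pi - t\<close>, since the relation for \<open>p j\<close> sees
    only the cosine.\<close>
  define j' where "j' = (if j \<le> k then j else 2 * k - j)"
  have "cos (angle k j') = cos (angle k j)"
  proof (cases "j \<le> k")
    case False
    then have "angle k j' = 2 * pi - angle k j"
      using j k by (simp add: j'_def angle_def of_nat_diff field_simps)
    then show ?thesis by simp
  qed (simp add: j'_def)
  \<comment> \<open>\<open>p j\<close> is a combination of the orbit of \<open>w\<close>. This
    clause later carries orthogonality to the frame over from the orbit to
    \<open>p j\<close>.\<close>
  moreover have "x \<bullet> p j = 0" if "x \<in> carrier_vec N" "\<And>l. x \<bullet> (M ^\<^sub>m l *\<^sub>v w) = 0" for x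
    using that unfolding p_def by (simp add: scalar_prod_vec_sum) (simp add: f_def)
  moreover have "j' \<le> k" using j by (auto simp: j'_def)
  ultimately show thesis using j rec[of j] by (intro that[of "p j" j']) (auto simp: p_def)
qed

end

section \<open>Isotypic vectors orthogonal to a partial frame\<close>

lemma rotated_eq_0D:
  fixes a b t :: real
  assumes 1: "cos t * a + sin t * b = 0" and 2: "- sin t * a + cos t * b = 0"
  shows "a = 0 \<and> b = 0"
proof -
  have *: "(c\<^sup>2 + s\<^sup>2) * a = c * (c * a + s * b) - s * (- s * a + c * b)"
    "(c\<^sup>2 + s\<^sup>2) * b = s * (c * a + s * b) + c * (- s * a + c * b)" for c s
    by (simp_all add: algebra_simps power2_eq_square)
  show ?thesis using *[of "cos t" "sin t"] unfolding 1 2 by simp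
qed

text \<open>Applying the isometry to both factors and expanding the second image of \<open>p\<close>
  shows that the unknown product \<open>x\<close> satisfies \<open>x = 2 * c - x\<close>.\<close>

lemma (in finite_order_isometry) scalar_prod_mult_M:
  assumes "p \<in> carrier_vec N" "p \<bullet> p = 1"
    and MMp: "M *\<^sub>v (M *\<^sub>v p) = 2 * c \<cdot>\<^sub>v (M *\<^sub>v p) - p"
  shows "p \<bullet> (M *\<^sub>v p) = c"
proof -
  have "p \<bullet> (M *\<^sub>v p) = (M *\<^sub>v p) \<bullet> (M *\<^sub>v (M *\<^sub>v p))"
    using assms by (subst isometry) auto
  also have "\<dots> = 2 * c * ((M *\<^sub>v p) \<bullet> (M *\<^sub>v p)) - (M *\<^sub>v p) \<bullet> p"
    unfolding MMp using assms by (subst scalar_prod_minus_distrib[of _ N]) auto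
  also have "\<dots> = 2 * c - p \<bullet> (M *\<^sub>v p)"
    using assms isometry[of p p] comm_scalar_prod[of p N "M *\<^sub>v p"] by simp
  finally show ?thesis by simp
qed

text \<open>This is the squared length of the part of \<open>M p\<close> orthogonal to
  \<open>p\<close>. For \<open>c = cos t\<close> it is the square of \<open>sin t\<close>, which
  decides between an eigenplane and an eigenvector.\<close>

lemma (in finite_order_isometry) norm_sub_scaled:
  assumes "p \<in> carrier_vec N" "p \<bullet> p = 1"
    and MMp: "M *\<^sub>v (M *\<^sub>v p) = 2 * c \<cdot>\<^sub>v (M *\<^sub>v p) - p"
  shows "(M *\<^sub>v p - c \<cdot>\<^sub>v p) \<bullet> (M *\<^sub>v p - c \<cdot>\<^sub>v p) = 1 - c\<^sup>2"
proof -
  have "(M *\<^sub>v p - c \<cdot>\<^sub>v p) \<bullet> (M *\<^sub>v p - c \<cdot>\<^sub>v p) =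
    (M *\<^sub>v p) \<bullet> (M *\<^sub>v p) - c * ((M *\<^sub>v p) \<bullet> p) - c * (p \<bullet> (M *\<^sub>v p)) + c * c * (p \<bullet> p)"
    using assms
    by (simp add: scalar_prod_minus_distrib[of _ N] minus_scalar_prod_distrib[of _ N] algebra_simps)
  also have "\<dots> = 1 - c\<^sup>2"
    using assms isometry[of p p] comm_scalar_prod[of p N "M *\<^sub>v p"] scalar_prod_mult_M[OF assms]
    by (simp add: power2_eq_square)
  finally show ?thesis .
qed

lemma scalar_prod_self_nonneg: "x \<bullet> x \<ge> (0 :: real)"
  by (auto simp: scalar_prod_def intro: sum_nonneg)

lemma scalar_prod_self_eq_0:
  fixes x :: "real vec"
  assumes "x \<in> carrier_vec N" "x \<bullet> x = 0"
  shows "x = 0\<^sub>v N"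
proof (rule eq_vecI)
  fix i assume i: "i < dim_vec (0\<^sub>v N :: real vec)"
  have "\<forall>i\<in>{0..<N}. x $ i * x $ i = 0"
    using assms by (subst sum_nonneg_eq_0_iff[symmetric]) (auto simp: scalar_prod_def)
  with i show "x $ i = 0\<^sub>v N $ i" by auto
qed (use assms in auto)

definition (in finite_order_isometry) rotates ::
    "nat \<Rightarrow> (nat \<Rightarrow> real vec) \<Rightarrow> (nat \<Rightarrow> real vec) \<Rightarrow> (nat \<Rightarrow> real) \<Rightarrow> bool" where
  "rotates r u v t \<longleftrightarrow> (\<forall>i<r.
    M *\<^sub>v u i = cos (t i) \<cdot>\<^sub>v u i + sin (t i) \<cdot>\<^sub>v v i \<and>
    M *\<^sub>v v i = - sin (t i) \<cdot>\<^sub>v u i + cos (t i) \<cdot>\<^sub>v v i)"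

text \<open>The image of \<open>w\<close> is orthogonal to the images of \<open>u i\<close> and
  \<open>v i\<close>. These are a rotation of the pair, and undoing the rotation gives orthogonality
  to the pair itself.\<close>

lemma (in finite_order_isometry) perp_mult_M:
  assumes on: "orthonormal_pairs N r u v" and rot: "rotates r u v t" and w: "perp N r u v w"
  shows "perp N r u v (M *\<^sub>v w)"
proof -
  have wc: "w \<in> carrier_vec N" using w by (simp add: perp_def)
  have "u i \<bullet> (M *\<^sub>v w) = 0 \<and> v i \<bullet> (M *\<^sub>v w) = 0" if i: "i < r" for i
  proof -
    have c: "u i \<in> carrier_vec N" "v i \<in> carrier_vec N" using on i by (auto simp: orthonormal_pairs_def)
    let ?a = "u i \<bullet> (M *\<^sub>v w)" and ?b = "v i \<bullet> (M *\<^sub>v w)"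
    have "cos (t i) * ?a + sin (t i) * ?b = (M *\<^sub>v u i) \<bullet> (M *\<^sub>v w)"
      using rot i c wc by (simp add: rotates_def add_scalar_prod_distrib[of _ N])
    then have 1: "cos (t i) * ?a + sin (t i) * ?b = 0"
      using w i by (simp add: isometry c wc perp_def)
    have "- sin (t i) * ?a + cos (t i) * ?b = (M *\<^sub>v v i) \<bullet> (M *\<^sub>v w)"
      using rot i c wc by (simp add: rotates_def add_scalar_prod_distrib[of _ N])
    then have 2: "- sin (t i) * ?a + cos (t i) * ?b = 0"
      using w i by (simp add: isometry c wc perp_def)
    from rotated_eq_0D[OF 1 2] show ?thesis by simp
  qed
  then show ?thesis using wc by (simp add: perp_def)
qed

text \<open>\<open>F\<close> holds eigenvectors that still lack a partner. Their eigenvalues are 1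
  or -1, so orthogonality to them is preserved by \<open>M\<close>, and the whole orbit of
  \<open>w\<close> stays in the complement of frame and \<open>F\<close>.\<close>

lemma (in finite_order_isometry) exists_isotypic_perp:
  assumes on: "orthonormal_pairs N r u v" and rot: "rotates r u v t"
    and F: "set F \<subseteq> carrier_vec N" "\<And>f. f \<in> set F \<Longrightarrow> \<exists>e. e * e = 1 \<and> M *\<^sub>v f = e \<cdot>\<^sub>v f"
    and len: "2 * r + length F < N"
  obtains p j where "perp N r u v p" "p \<bullet> p = 1" "\<And>f. f \<in> set F \<Longrightarrow> f \<bullet> p = 0" "j \<le> k"
    "M *\<^sub>v (M *\<^sub>v p) = 2 * cos (angle k j) \<cdot>\<^sub>v (M *\<^sub>v p) - p"
proof -
  obtain w where w: "perp N r u v w" "w \<noteq> 0\<^sub>v N" "\<And>f. f \<in> set F \<Longrightarrow> f \<bullet> w = 0"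
    using exists_perp[OF on F(1) len] by blast
  then have wc: "w \<in> carrier_vec N" by (simp add: perp_def)
  have inv: "perp N r u v (M ^\<^sub>m l *\<^sub>v w) \<and> (\<forall>f\<in>set F. f \<bullet> (M ^\<^sub>m l *\<^sub>v w) = 0)" for l
  proof (induction l)
    case 0
    then show ?case using w wc M by simp
  next
    case (Suc l)
    let ?x = "M ^\<^sub>m l *\<^sub>v w"
    have xc: "?x \<in> carrier_vec N" using Suc by (simp add: perp_def)
    have S: "M ^\<^sub>m Suc l *\<^sub>v w = M *\<^sub>v ?x" by (rule pow_Suc_mult_vec[OF wc])
    have "f \<bullet> (M *\<^sub>v ?x) = 0" if f: "f \<in> set F" for f
    proof -
      obtain e where e: "e * e = 1" "M *\<^sub>v f = e \<cdot>\<^sub>v f" using F(2)[OF f] by blast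
      have fc: "f \<in> carrier_vec N" using f F by auto
      have "e * (f \<bullet> (M *\<^sub>v ?x)) = (M *\<^sub>v f) \<bullet> (M *\<^sub>v ?x)"
        using fc xc by (simp add: e(2))
      also have "\<dots> = 0" using Suc f by (simp add: isometry[OF fc xc])
      finally show ?thesis using e(1) by auto
    qed
    then show ?case using perp_mult_M[OF on rot, of ?x] Suc S by simp
  qed
  obtain p j where p: "p \<in> carrier_vec N" "p \<noteq> 0\<^sub>v N" "j \<le> k"
    "M *\<^sub>v (M *\<^sub>v p) = 2 * cos (angle k j) \<cdot>\<^sub>v (M *\<^sub>v p) - p"
    and px: "\<And>x. x \<in> carrier_vec N \<Longrightarrow> (\<And>l. x \<bullet> (M ^\<^sub>m l *\<^sub>v w) = 0) \<Longrightarrow> x \<bullet> p = 0"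
    using exists_isotypic_vector[OF wc w(2)] by blast
  have pp: "p \<bullet> p > 0"
    using scalar_prod_self_eq_0[OF p(1)] p(2) scalar_prod_self_nonneg[of p] by force
  define s where "s = 1 / sqrt (p \<bullet> p)"
  define q where "q = s \<cdot>\<^sub>v p"
  have xq: "x \<bullet> q = 0" if "x \<in> carrier_vec N" "\<And>l. x \<bullet> (M ^\<^sub>m l *\<^sub>v w) = 0" for x
    using px[OF that] that(1) p(1) by (simp add: q_def)
  have "perp N r u v q"
    using on inv p(1) unfolding perp_def orthonormal_pairs_def by (auto intro!: xq) (simp add: q_def)
  moreover have "q \<bullet> q = 1"
    using pp p(1) by (simp add: q_def s_def)
  moreover have "f \<bullet> q = 0" if "f \<in> set F" for f
    using F inv that by (intro xq) auto
  moreover have "M *\<^sub>v q = s \<cdot>\<^sub>v (M *\<^sub>v p)" "M *\<^sub>v (M *\<^sub>v q) = s \<cdot>\<^sub>v (M *\<^sub>v (M *\<^sub>v p))"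
    unfolding q_def using p(1) M by (simp_all add: mult_mat_vec[of _ N N])
  then have "M *\<^sub>v (M *\<^sub>v q) = 2 * cos (angle k j) \<cdot>\<^sub>v (M *\<^sub>v q) - q"
    unfolding p(4) using p(1) M by (intro eq_vecI) (auto simp: q_def algebra_simps)
  ultimately show thesis using p(3) that by blast
qed

section \<open>Completing the frame by rotated planes\<close>

context finite_order_isometry
begin

text \<open>The partner \<open>q\<close> is forced by the required formula for the image of
  \<open>p\<close>; the norm and scalar product computed above make it a unit vector orthogonal to
  \<open>p\<close>.\<close>

lemma exists_rotated_partner:
  assumes p: "perp N r u v p" "p \<bullet> p = 1"
    and MMp: "M *\<^sub>v (M *\<^sub>v p) = 2 * cos t \<cdot>\<^sub>v (M *\<^sub>v p) - p"
    and on: "orthonormal_pairs N r u v" and rot: "rotates r u v t'" and s: "sin t \<noteq> 0"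
  obtains q where "perp N r u v q" "q \<bullet> q = 1" "p \<bullet> q = 0"
    "M *\<^sub>v p = cos t \<cdot>\<^sub>v p + sin t \<cdot>\<^sub>v q" "M *\<^sub>v q = - sin t \<cdot>\<^sub>v p + cos t \<cdot>\<^sub>v q"
proof -
  have pc [simp]: "p \<in> carrier_vec N" using p by (simp add: perp_def)
  have Mpc [simp]: "M *\<^sub>v p \<in> carrier_vec N" by simp
  define q where "q = (1 / sin t) \<cdot>\<^sub>v (M *\<^sub>v p - cos t \<cdot>\<^sub>v p)"
  have qc: "q \<in> carrier_vec N" by (simp add: q_def)
  have ortho: "x \<bullet> q = (1 / sin t) * (x \<bullet> (M *\<^sub>v p) - cos t * (x \<bullet> p))" if "x \<in> carrier_vec N" for x
    using that unfolding q_def by (simp add: scalar_prod_minus_distrib[of _ N])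
  have "perp N r u v q"
    using perp_mult_M[OF on rot p(1)] p(1) qc on by (auto simp: perp_def ortho orthonormal_pairs_def)
  moreover have "q \<bullet> q = (1 / sin t)\<^sup>2 * (1 - (cos t)\<^sup>2)"
    using norm_sub_scaled[OF pc p(2) MMp] unfolding q_def by (simp add: power2_eq_square)
  then have "q \<bullet> q = 1"
    using s by (simp add: sin_squared_eq[symmetric] power_divide)
  moreover have "p \<bullet> q = 0"
    using p scalar_prod_mult_M[OF pc p(2) MMp] by (simp add: ortho)
  moreover have Mp: "M *\<^sub>v p = cos t \<cdot>\<^sub>v p + sin t \<cdot>\<^sub>v q"
    using s M by (intro eq_vecI) (auto simp: q_def carrier_vecD[OF pc] simp del: index_mult_mat_vec)
  moreover have "M *\<^sub>v q = - sin t \<cdot>\<^sub>v p + cos t \<cdot>\<^sub>v q"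
  proof -
    have "M *\<^sub>v q = (1 / sin t) \<cdot>\<^sub>v (M *\<^sub>v (M *\<^sub>v p) - cos t \<cdot>\<^sub>v (M *\<^sub>v p))"
      unfolding q_def using M
      by (simp add: mult_mat_vec[of _ N N] mult_minus_distrib_mat_vec[of _ N N])
    also have "\<dots> = (1 / sin t) \<cdot>\<^sub>v (cos t \<cdot>\<^sub>v (M *\<^sub>v p) - p)"
      unfolding MMp using M
      by (intro eq_vecI) (auto simp: carrier_vecD[OF pc] algebra_simps simp del: index_mult_mat_vec)
    also have "\<dots> = - sin t \<cdot>\<^sub>v p + cos t \<cdot>\<^sub>v q"
    proof (rule eq_vecI)
      fix i assume "i < dim_vec (- sin t \<cdot>\<^sub>v p + cos t \<cdot>\<^sub>v q)"
      then have i: "i < N" using qc by simp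
      have "(1 / sin t) * (cos t * (cos t * x + sin t * y) - x) = - sin t * x + cos t * y" for x y
      proof -
        have "cos t * (cos t * x + sin t * y) - x = ((cos t)\<^sup>2 - 1) * x + sin t * (cos t * y)"
          by (simp add: algebra_simps power2_eq_square)
        also have "\<dots> = sin t * (- sin t * x + cos t * y)"
          unfolding cos_squared_eq by (simp add: algebra_simps power2_eq_square)
        finally show ?thesis using s by simp
      qed
      then show "((1 / sin t) \<cdot>\<^sub>v (cos t \<cdot>\<^sub>v (M *\<^sub>v p) - p)) $ i = (- sin t \<cdot>\<^sub>v p + cos t \<cdot>\<^sub>v q) $ i"
        unfolding Mp using i qc by (simp add: carrier_vecD[OF pc])
    qed (use qc in simp)
    finally show ?thesis .
  qed
  ultimately show thesis using that by blast
qed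

text \<open>When the sine vanishes, the part of \<open>M p\<close> orthogonal to \<open>p\<close>
  has length 0.\<close>

lemma isotypic_eigenvector:
  assumes "p \<in> carrier_vec N" "p \<bullet> p = 1"
    and "M *\<^sub>v (M *\<^sub>v p) = 2 * cos t \<cdot>\<^sub>v (M *\<^sub>v p) - p" and "sin t = 0"
  shows "M *\<^sub>v p = cos t \<cdot>\<^sub>v p"
proof -
  have "1 - (cos t)\<^sup>2 = 0" using assms(4) by (simp add: sin_squared_eq[symmetric])
  then have "M *\<^sub>v p - cos t \<cdot>\<^sub>v p = 0\<^sub>v N"
    using norm_sub_scaled[OF assms(1-3)] assms by (intro scalar_prod_self_eq_0) auto
  then have "(M *\<^sub>v p - cos t \<cdot>\<^sub>v p) $ i = 0" if "i < N" for i using that by simp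
  then show ?thesis
    using assms M by (intro eq_vecI) (auto simp del: index_mult_mat_vec)
qed

definition rotation_pairs :: "nat \<Rightarrow> (nat \<Rightarrow> real vec) \<Rightarrow> (nat \<Rightarrow> real vec) \<Rightarrow> (nat \<Rightarrow> nat) \<Rightarrow> bool" where
  "rotation_pairs r u v j \<longleftrightarrow> orthonormal_pairs N r u v \<and> (\<forall>i<r. j i \<le> k) \<and> rotates r u v (\<lambda>i. angle k (j i))"

lemma rotation_pairs_extend:
  assumes "rotation_pairs r u v j" "perp N r u v p" "perp N r u v q"
    and "p \<bullet> p = 1" "q \<bullet> q = 1" "p \<bullet> q = 0" "l \<le> k"
    and "M *\<^sub>v p = cos (angle k l) \<cdot>\<^sub>v p + sin (angle k l) \<cdot>\<^sub>v q"
    and "M *\<^sub>v q = - sin (angle k l) \<cdot>\<^sub>v p + cos (angle k l) \<cdot>\<^sub>v q"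
  shows "rotation_pairs (Suc r) (u(r := p)) (v(r := q)) (j(r := l))"
  using assms orthonormal_pairs_extend[of N r u v p q]
  by (auto simp: rotation_pairs_def rotates_def less_Suc_eq)

text \<open>An orthonormal family that cannot be extended leaves a complement on which \<open>M\<close> has only
  simple eigenvalues among \<open>1\<close> and \<open>-1\<close>, hence a plane on which \<open>M\<close> is a reflection.\<close>

lemma rotation_pairs_Suc:
  assumes N: "N = 2 * n" and det: "det M = 1" and r: "r < n" and ruvj: "rotation_pairs r u v j"
  shows "\<exists>u v j. rotation_pairs (Suc r) u v j"
proof (rule ccontr)
  assume nex: "\<not> ?thesis"
  have on: "orthonormal_pairs N r u v" and rot: "rotates r u v (\<lambda>i. angle k (j i))"
    using ruvj by (auto simp: rotation_pairs_def)
  have angles: "angle k 0 = 0" "angle k k = pi" using k by (auto simp: angle_def)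
  \<comment> \<open>Two orthonormal eigenvectors with the same eigenvalue span a plane rotated by
    \<open>0\<close> or \<open>pi\<close>, which would extend the frame.\<close>
  have same: False if p: "perp N r u v p" "p \<bullet> p = 1" and q: "perp N r u v q" "q \<bullet> q = 1" and pq: "p \<bullet> q = 0"
    and e: "e = 1 \<or> e = -1" and eig: "M *\<^sub>v p = e \<cdot>\<^sub>v p" "M *\<^sub>v q = e \<cdot>\<^sub>v q" for p q e
  proof -
    have c: "p \<in> carrier_vec N" "q \<in> carrier_vec N" using p q by (auto simp: perp_def)
    from e have "e = cos (angle k 0) \<or> e = cos (angle k k)" by (simp add: angles)
    then obtain l where l: "l = 0 \<or> l = k" "e = cos (angle k l)" by blast
    have s: "sin (angle k l) = 0" using l(1) by (auto simp: angles)
    have "M *\<^sub>v p = cos (angle k l) \<cdot>\<^sub>v p + sin (angle k l) \<cdot>\<^sub>v q"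
      "M *\<^sub>v q = - sin (angle k l) \<cdot>\<^sub>v p + cos (angle k l) \<cdot>\<^sub>v q"
      using c unfolding eig l(2) s by (auto intro!: eq_vecI)
    with rotation_pairs_extend[OF ruvj p(1) q(1) p(2) q(2) pq] l(1) nex show False by blast
  qed
  \<comment> \<open>A nonzero sine would supply a partner and extend the frame, so isotypic vectors
    of the complement are eigenvectors for 1 or -1.\<close>
  have vec: "\<exists>p e. perp N r u v p \<and> p \<bullet> p = 1 \<and> (\<forall>f\<in>set F. f \<bullet> p = 0) \<and> (e = 1 \<or> e = -1) \<and> M *\<^sub>v p = e \<cdot>\<^sub>v p"
    if F: "set F \<subseteq> carrier_vec N" "\<And>f. f \<in> set F \<Longrightarrow> \<exists>e. e * e = 1 \<and> M *\<^sub>v f = e \<cdot>\<^sub>v f"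
      "2 * r + length F < N" for F
  proof -
    obtain p l where p: "perp N r u v p" "p \<bullet> p = 1" "\<And>f. f \<in> set F \<Longrightarrow> f \<bullet> p = 0" "l \<le> k"
      and MMp: "M *\<^sub>v (M *\<^sub>v p) = 2 * cos (angle k l) \<cdot>\<^sub>v (M *\<^sub>v p) - p"
      using exists_isotypic_perp[OF on rot F] by metis
    have s: "sin (angle k l) = 0"
    proof (rule ccontr)
      assume "sin (angle k l) \<noteq> 0"
      then obtain q where "perp N r u v q" "q \<bullet> q = 1" "p \<bullet> q = 0"
        "M *\<^sub>v p = cos (angle k l) \<cdot>\<^sub>v p + sin (angle k l) \<cdot>\<^sub>v q"
        "M *\<^sub>v q = - sin (angle k l) \<cdot>\<^sub>v p + cos (angle k l) \<cdot>\<^sub>v q"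
        by (rule exists_rotated_partner[OF p(1,2) MMp on rot])
      with rotation_pairs_extend[OF ruvj p(1) _ p(2)] p(4) nex show False by blast
    qed
    then have "cos (angle k l) = 1 \<or> cos (angle k l) = -1" by (metis cos_one_sin_zero sin_zero_abs_cos_one abs_eq_iff abs_1)
    moreover have "M *\<^sub>v p = cos (angle k l) \<cdot>\<^sub>v p"
      using isotypic_eigenvector[OF _ p(2) MMp s] p(1) by (simp add: perp_def)
    ultimately show ?thesis using p by blast
  qed
  obtain p e where p: "perp N r u v p" "p \<bullet> p = 1" and e: "e = 1 \<or> e = -1" and Mp: "M *\<^sub>v p = e \<cdot>\<^sub>v p"
    using vec[of "[]"] r N by auto
  have ee: "e * e = 1" using e by auto
  have pc: "p \<in> carrier_vec N" using p by (simp add: perp_def)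
  obtain q e' where q: "perp N r u v q" "q \<bullet> q = 1" "p \<bullet> q = 0" and e': "e' = 1 \<or> e' = -1" and Mq: "M *\<^sub>v q = e' \<cdot>\<^sub>v q"
    using vec[of "[p]"] r N pc ee Mp by auto
  have qc: "q \<in> carrier_vec N" using q by (simp add: perp_def)
  have "e' \<noteq> e" using same[OF p q e Mp] Mq by blast
  with e e' have e'_eq: "e' = - e" by auto
  show False
  proof (cases "2 * r + 2 < N")
    case True
    have "\<exists>a. a * a = 1 \<and> M *\<^sub>v f = a \<cdot>\<^sub>v f" if "f \<in> set [p, q]" for f
      using that Mp Mq ee e'_eq by (metis empty_iff minus_mult_minus set_ConsD set_empty)
    with vec[of "[p, q]"] True pc qc obtain w a where w: "perp N r u v w" "w \<bullet> w = 1" "p \<bullet> w = 0" "q \<bullet> w = 0"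
      and a: "a = 1 \<or> a = -1" and Mw: "M *\<^sub>v w = a \<cdot>\<^sub>v w" by auto
    \<comment> \<open>Pigeonhole: three orthonormal eigenvectors share only two possible
      eigenvalues.\<close>
    from a e e'_eq consider "a = e" | "a = e'" by auto
    then show False
      using same[OF p w(1,2,3) e Mp] same[OF q(1,2) w(1,2,4) e' Mq] Mw by cases auto
  next
    case False
    then have n: "n = Suc r" using r N by simp
    \<comment> \<open>Now \<open>p\<close> and \<open>q\<close> fill the last plane, where
      \<open>M\<close> acts by \<open>e\<close> and \<open>- e\<close>. The rotated planes
      contribute determinant 1, so \<open>M\<close> would have determinant -1.\<close>
    let ?u = "u(r := p)" and ?v = "v(r := q)"
    let ?a = "(\<lambda>i. cos (angle k (j i)))(r := e)" and ?d = "(\<lambda>i. cos (angle k (j i)))(r := - e)"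
    let ?s = "(\<lambda>i. sin (angle k (j i)))(r := 0)"
    let ?Q = "pair_mat n ?u ?v" and ?D = "diag_block n ?a (\<lambda>i. - ?s i) ?s ?d"
    have on': "orthonormal_pairs (2 * n) n ?u ?v"
      using orthonormal_pairs_extend[OF on p(1) q(1) p(2) q(2,3)] N n by simp
    have "M * ?Q = ?Q * ?D"
    proof (rule pair_mat_conj[OF _ on'])
      fix i assume "i < n"
      then have "i < r \<or> i = r" using n by auto
      then show "M *\<^sub>v ?u i = ?a i \<cdot>\<^sub>v ?u i + ?s i \<cdot>\<^sub>v ?v i" "M *\<^sub>v ?v i = - ?s i \<cdot>\<^sub>v ?u i + ?d i \<cdot>\<^sub>v ?v i"
        using rot pc qc Mp Mq e'_eq by (auto simp: rotates_def intro!: eq_vecI)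
    qed (use M N in simp)
    then have "det (M * ?Q) = det (?Q * ?D)" by simp
    then have "det M * det ?Q = det ?Q * det ?D"
      using M N by (simp add: det_mult[of _ "2 * n"])
    moreover have "det (transpose_mat ?Q * ?Q) = 1"
      unfolding pair_mat_orthogonal[OF on'] by simp
    then have "det ?Q \<noteq> 0"
      by (auto simp: det_mult[of _ "2 * n"])
    ultimately have "det ?D = 1" using det by simp
    moreover have "det ?D = (\<Prod>i<r. cos (angle k (j i)) * cos (angle k (j i)) + sin (angle k (j i)) * sin (angle k (j i))) * - (e * e)"
      unfolding det_diag_block n by simp
    moreover have "(\<Prod>i<r. cos (angle k (j i)) * cos (angle k (j i)) + sin (angle k (j i)) * sin (angle k (j i))) = 1"
      by (intro prod.neutral) (simp flip: power2_eq_square)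
    ultimately show False by (simp add: ee)
  qed
qed

lemma exists_rotation_pairs:
  assumes "N = 2 * n" "det M = 1" "r \<le> n"
  shows "\<exists>u v j. rotation_pairs r u v j"
  using assms(3)
proof (induction r)
  case 0
  then show ?case by (auto simp: rotation_pairs_def orthonormal_pairs_def rotates_def)
next
  case (Suc r)
  then show ?case using rotation_pairs_Suc[OF assms(1,2), of r] by auto
qed

end

section \<open>Conjugacy invariants\<close>

lemma sum_split_half: "(\<Sum>i<2*n. f i) = (\<Sum>i<n. f i) + (\<Sum>i<n. f (n + i))" for f :: "nat \<Rightarrow> 'a :: comm_monoid_add"
proof -
  have "(\<Sum>i<n + m. f i) = (\<Sum>i<n. f i) + (\<Sum>i<m. f (n + i))" for m
    by (induction m) (auto simp: add.assoc)
  then show ?thesis by (simp add: mult_2)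
qed

lemma mult_diag_block_index:
  assumes "H \<in> carrier_mat (2 * n) (2 * n)" "i < 2 * n" "y < n"
  shows "(H * diag_block n a b c d) $$ (i, y) = H $$ (i, y) * a y + H $$ (i, n + y) * c y"
    and "(H * diag_block n a b c d) $$ (i, n + y) = H $$ (i, y) * b y + H $$ (i, n + y) * d y"
  using assms
  by (simp_all add: scalar_prod_def atLeast0LessThan sum_split_half diag_block_index
      if_distrib[of "\<lambda>x. _ * x"] cong: if_cong)

lemma diag_block_mult_index:
  assumes "H \<in> carrier_mat (2 * n) (2 * n)" "j < 2 * n" "x < n"
  shows "(diag_block n a b c d * H) $$ (x, j) = a x * H $$ (x, j) + b x * H $$ (n + x, j)"
    and "(diag_block n a b c d * H) $$ (n + x, j) = c x * H $$ (x, j) + d x * H $$ (n + x, j)"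
  using assms
  by (simp_all add: scalar_prod_def atLeast0LessThan sum_split_half diag_block_index
      if_distrib[of "\<lambda>x. x * _"] cong: if_cong)

text \<open>Such a matrix is complex linear for the complex structure swapping the two halves, so its
  determinant is the squared modulus of the complex determinant of \<open>P + \<i> Q\<close>.\<close>

lemma det_complex_linear_nonneg:
  fixes h :: "real mat"
  assumes h: "h \<in> carrier_mat (2 * n) (2 * n)"
    and 1: "\<And>x y. x < n \<Longrightarrow> y < n \<Longrightarrow> h $$ (n + x, n + y) = h $$ (x, y)"
    and 2: "\<And>x y. x < n \<Longrightarrow> y < n \<Longrightarrow> h $$ (n + x, y) = - h $$ (x, n + y)"
  shows "det h \<ge> 0"
proof -
  interpret cnj: comm_ring_hom cnj by unfold_locales auto
  define H where "H = map_mat complex_of_real h"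
  define Z where "Z = mat n n (\<lambda>(x, y). complex_of_real (h $$ (x, y)) + \<i> * complex_of_real (h $$ (x, n + y)))"
  define W where "W = mat n n (\<lambda>(x, y). complex_of_real (h $$ (x, n + y)))"
  \<comment> \<open>\<open>?K\<close> is the inverse of \<open>?L\<close>, and both have determinant
    1. The change of basis adds \<open>\<i>\<close> times the second half of the columns to the
    first, which makes \<open>H\<close> block triangular with diagonal blocks \<open>Z\<close> and
    its conjugate.\<close>
  let ?L = "diag_block n (\<lambda>_. 1) (\<lambda>_. 0) (\<lambda>_. \<i>) (\<lambda>_. 1)"
  let ?K = "diag_block n (\<lambda>_. 1) (\<lambda>_. 0) (\<lambda>_. - \<i>) (\<lambda>_. 1)"
  have H: "H \<in> carrier_mat (2 * n) (2 * n)" using h by (simp add: H_def)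
  have HL: "H * ?L \<in> carrier_mat (2 * n) (2 * n)" by (rule mult_carrier_mat[OF H diag_block_carrier])
  have Z: "Z \<in> carrier_mat n n" "W \<in> carrier_mat n n" "map_mat cnj Z \<in> carrier_mat n n"
    by (auto simp: Z_def W_def)
  have Hi: "H $$ (i, j) = complex_of_real (h $$ (i, j))" if "i < 2 * n" "j < 2 * n" for i j
    using h that by (simp add: H_def)
  have "?K * (H * ?L) = four_block_mat Z W (0\<^sub>m n n) (map_mat cnj Z)"
  proof (rule eq_mat_blockI[of _ n])
    show "?K * (H * ?L) \<in> carrier_mat (2 * n) (2 * n)" by (rule mult_carrier_mat[OF diag_block_carrier HL])
    show "four_block_mat Z W (0\<^sub>m n n) (map_mat cnj Z) \<in> carrier_mat (2 * n) (2 * n)"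
      unfolding mult_2 by (rule four_block_carrier_mat) (use Z in auto)
    fix x y assume xy: "x < n" "y < n"
    then show "(?K * (H * ?L)) $$ (x, y) = four_block_mat Z W (0\<^sub>m n n) (map_mat cnj Z) $$ (x, y)"
      "(?K * (H * ?L)) $$ (x, n + y) = four_block_mat Z W (0\<^sub>m n n) (map_mat cnj Z) $$ (x, n + y)"
      "(?K * (H * ?L)) $$ (n + x, y) = four_block_mat Z W (0\<^sub>m n n) (map_mat cnj Z) $$ (n + x, y)"
      "(?K * (H * ?L)) $$ (n + x, n + y) = four_block_mat Z W (0\<^sub>m n n) (map_mat cnj Z) $$ (n + x, n + y)"
      by (simp_all add: diag_block_mult_index[OF HL] mult_diag_block_index[OF H] Hi 1 2 Z_def W_def
          algebra_simps del: index_mult_mat)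
  qed
  then have "det (?K * (H * ?L)) = det Z * det (map_mat cnj Z)"
    using det_four_block_mat_lower_left_zero[OF Z(1,2) refl Z(3)] by simp
  also have "\<dots> = det Z * cnj (det Z)" by (simp add: cnj.hom_det)
  also have "\<dots> = complex_of_real ((cmod (det Z))\<^sup>2)" by (rule complex_norm_square[symmetric])
  also have "det (?K * (H * ?L)) = complex_of_real (det h)"
    using H HL by (simp add: det_mult[of _ "2 * n"] det_diag_block H_def of_real_hom.hom_det)
  finally have "det h = (cmod (det Z))\<^sup>2" unfolding of_real_eq_iff .
  then show ?thesis by simp
qed

text \<open>Commuting with the rotation and with its inverse isolates the sine parts. Entrywise, the
  defects from complex linearity are annihilated by \<open>sin (t x) + sin (t y)\<close>, which is
  positive.\<close>

lemma det_centralizer_rotation_mat_nonneg: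
  assumes h: "h \<in> carrier_mat (2 * n) (2 * n)" and comm: "h * rotation_mat n t = rotation_mat n t * h"
    and s: "\<And>i. i < n \<Longrightarrow> sin (t i) > 0"
  shows "det h \<ge> 0"
proof -
  let ?R = "rotation_mat n t" and ?R' = "rotation_mat n (\<lambda>i. - t i)"
  have assoc: "A * B * C = A * (B * C)"
    if "A \<in> carrier_mat (2*n) (2*n)" "B \<in> carrier_mat (2*n) (2*n)" "C \<in> carrier_mat (2*n) (2*n)"
    for A B C :: "real mat"
    using that by (rule assoc_mult_mat)
  have inv: "?R * ?R' = 1\<^sub>m (2 * n)" "?R' * ?R = 1\<^sub>m (2 * n)"
    by (simp_all add: rotation_mat_mult rotation_mat_eq_one)
  have "h * ?R' = (?R' * ?R) * (h * ?R')" using h inv by simp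
  also have "\<dots> = ?R' * ((?R * h) * ?R')" using h by (simp add: assoc)
  also have "\<dots> = ?R' * (h * (?R * ?R'))" using h by (simp add: assoc flip: comm)
  finally have comm': "h * ?R' = ?R' * h" using h by (simp add: inv)
  have "h $$ (n + x, n + y) = h $$ (x, y) \<and> h $$ (n + x, y) = - h $$ (x, n + y)"
    if xy: "x < n" "y < n" for x y
  proof -
    have e: "(h * ?R) $$ (i, j) = (?R * h) $$ (i, j)" "(h * ?R') $$ (i, j) = (?R' * h) $$ (i, j)" for i j
      by (simp_all add: comm comm')
    note idx = mult_diag_block_index[OF h _ xy(2)] diag_block_mult_index[OF h _ xy(1)]
    let ?P = "h $$ (x, y)" and ?Q = "h $$ (x, n + y)" and ?S = "h $$ (n + x, y)" and ?T = "h $$ (n + x, n + y)"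
    let ?sx = "sin (t x)" and ?sy = "sin (t y)"
    have "?Q * ?sy = - ?S * ?sx" "?S * ?sx = - ?Q * ?sy \<and> ?S * ?sy = - ?Q * ?sx" "?P * ?sy = ?T * ?sx" "?T * ?sy = ?P * ?sx"
      using e[of x y] e[of x "n + y"] e[of "n + x" y] e[of "n + x" "n + y"] xy
      unfolding rotation_mat_def by (simp_all add: idx algebra_simps del: index_mult_mat)
    then have "(?T - ?P) * (?sx + ?sy) = 0" "(?S + ?Q) * (?sx + ?sy) = 0"
      by (simp_all add: algebra_simps)
    moreover have "?sx + ?sy > 0" using s[OF xy(1)] s[OF xy(2)] by simp
    ultimately show ?thesis by auto
  qed
  then show ?thesis by (intro det_complex_linear_nonneg[OF h]) auto
qed

section \<open>Angles recovered from characteristic polynomials\<close>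

lemma rotation_mats_intertwined_imp:
  assumes g: "g \<in> carrier_mat (2 * n) (2 * n)" "det g \<noteq> 0"
    and eq: "rotation_mat n s * g = g * rotation_mat n t"
  shows "(\<Prod>i<n. x\<^sup>2 - 2 * cos (s i) * x + 1) = (\<Prod>i<n. x\<^sup>2 - 2 * cos (t i) * x + 1)"
proof -
  let ?X = "x \<cdot>\<^sub>m 1\<^sub>m (2 * n)"
  have "(?X - rotation_mat n s) * g = x \<cdot>\<^sub>m g - rotation_mat n s * g"
    using g
    by (subst minus_mult_distrib_mat[of _ "2*n" "2*n"]) (auto simp: mult_smult_assoc_mat[of _ "2*n" "2*n"])
  also have "\<dots> = g * (?X - rotation_mat n t)"
    unfolding eq using g mult_smult_distrib[OF g(1) one_carrier_mat, of x]
    by (subst mult_minus_distrib_mat[of _ "2*n" "2*n"]) auto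
  finally have "det ((?X - rotation_mat n s) * g) = det (g * (?X - rotation_mat n t))" by simp
  then have "det (?X - rotation_mat n s) * det g = det g * det (?X - rotation_mat n t)"
    using g by (simp add: det_mult[of _ "2 * n"] minus_carrier_mat)
  with g show ?thesis by (simp add: det_char_rotation_mat)
qed

text \<open>The two sides are \<open>x\<^sup>n\<close> times monic polynomials in \<open>y = x + 1 / x\<close> with roots \<open>2 f a\<close>.\<close>

lemma image_mset_eq_of_reciprocal_products:
  fixes f :: "'a \<Rightarrow> real"
  assumes size: "size A = size B"
    and eq: "\<And>x. (\<Prod>a\<in>#A. x\<^sup>2 - 2 * f a * x + 1) = (\<Prod>a\<in>#B. x\<^sup>2 - 2 * f a * x + 1)"
  shows "image_mset f A = image_mset f B"
proof -
  define q where "q A = (\<Prod>a\<in>#A. [:- (2 * f a), 1:])" for A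
  have poly_q: "x ^ size A * poly (q A) (x + 1 / x) = (\<Prod>a\<in>#A. x\<^sup>2 - 2 * f a * x + 1)" if "x \<noteq> 0" for x A
  proof (induction A)
    case (add a A)
    have "x ^ size (add_mset a A) * poly (q (add_mset a A)) (x + 1 / x) =
        (x * (x + 1 / x - 2 * f a)) * (x ^ size A * poly (q A) (x + 1 / x))"
      by (simp add: q_def algebra_simps)
    also have "x * (x + 1 / x - 2 * f a) = x\<^sup>2 - 2 * f a * x + 1"
      using that by (simp add: field_simps power2_eq_square)
    finally show ?case by (simp add: add.IH)
  qed (simp add: q_def)
  \<comment> \<open>From 2 on, \<open>x + 1 / x = y\<close> has a positive real solution; these
    infinitely many values of \<open>y\<close> determine the polynomials.\<close>
  have "poly (q A) y = poly (q B) y" if y: "y \<ge> 2" for y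
  proof -
    define x where "x = (y + sqrt (y\<^sup>2 - 4)) / 2"
    have "y\<^sup>2 \<ge> 2\<^sup>2" using y by (intro power_mono) auto
    then have "x > 0" "sqrt (y\<^sup>2 - 4) ^ 2 = y\<^sup>2 - 4" using y by (auto simp: x_def intro!: add_pos_nonneg)
    then have "x * x + 1 = y * x" by (simp add: x_def field_simps power2_eq_square)
    then have "x + 1 / x = y" using \<open>x > 0\<close> by (simp add: field_simps)
    moreover have "x ^ size B * poly (q A) (x + 1 / x) = x ^ size B * poly (q B) (x + 1 / x)"
      using poly_q[of x A] poly_q[of x B] eq[of x] \<open>x > 0\<close> size by simp
    ultimately show ?thesis using \<open>x > 0\<close> by simp
  qed
  then have "{2..} \<subseteq> {y. poly (q A - q B) y = 0}" by auto
  then have "infinite {y. poly (q A - q B) y = 0}"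
    using infinite_Ici[of "2 :: real"] finite_subset by blast
  then have "q A = q B" using poly_roots_finite[of "q A - q B"] by auto
  moreover have roots: "proots (q A) = image_mset (\<lambda>a. 2 * f a) A" for A
  proof (induction A)
    case (add a A)
    have "q A \<noteq> 0" by (auto simp: q_def prod_mset_zero_iff)
    moreover have "q (add_mset a A) = [:- (2 * f a), 1:] * q A"
      unfolding q_def image_mset_add_mset prod_mset.add_mset ..
    ultimately show ?case using proots_mult[of "[:- (2 * f a), 1:]" "q A"] add.IH by simp
  qed (simp add: q_def)
  ultimately have "image_mset (\<lambda>a. 2 * f a) A = image_mset (\<lambda>a. 2 * f a) B"
    unfolding roots[symmetric] by simp
  then have "image_mset (\<lambda>x. x / 2) (image_mset (\<lambda>a. 2 * f a) A) = image_mset (\<lambda>x. x / 2) (image_mset (\<lambda>a. 2 * f a) B)"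
    by simp
  then show ?thesis by (simp add: image_mset.compositionality o_def)
qed

lemma image_mset_inj_onD:
  assumes "image_mset f A = image_mset f B" "inj_on f S" "set_mset A \<subseteq> S" "set_mset B \<subseteq> S"
  shows "A = B"
proof -
  have inv: "image_mset (inv_into S f) (image_mset f A) = A" if "set_mset A \<subseteq> S" for A
    using that assms(2) by (induction A) auto
  show ?thesis
    by (rule trans[OF inv[OF assms(3), symmetric] inv[OF assms(4), folded assms(1)]])
qed

lemma cos_angle_inj:
  assumes "k > 0"
  shows "inj_on (\<lambda>j. cos (angle k j)) {0..k}"
proof (rule inj_onI)
  fix a b assume ab: "a \<in> {0..k}" "b \<in> {0..k}" and eq: "cos (angle k a) = cos (angle k b)"
  have range: "0 \<le> angle k j" "angle k j \<le> pi" if "j \<le> k" for j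
    using that assms by (auto simp: angle_def field_simps)
  have "angle k a = angle k b"
    by (rule cos_inj_pi[OF range range eq]) (use ab in auto)
  then show "a = b" using assms by (simp add: angle_def)
qed

section \<open>Conjugacy classes of the special orthogonal group\<close>

text \<open>Multiplying a frame matrix by it on the right reverses the second vector of plane
  \<open>l\<close>; this is how the determinant of a frame is corrected.\<close>

definition reflection_mat :: "nat \<Rightarrow> nat \<Rightarrow> real mat" where
  "reflection_mat n l = diag_block n (\<lambda>_. 1) (\<lambda>_. 0) (\<lambda>_. 0) ((\<lambda>_. 1)(l := -1))"

lemma reflection_mat_carrier [simp]: "reflection_mat n l \<in> carrier_mat (2 * n) (2 * n)"
  by (simp add: reflection_mat_def)

lemma reflection_mat_orthogonal: "transpose_mat (reflection_mat n l) * reflection_mat n l = 1\<^sub>m (2 * n)"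
  unfolding reflection_mat_def diag_block_transpose diag_block_mult diag_block_one[symmetric]
  by (intro arg_cong4[where f = "diag_block n"]) auto

lemma det_reflection_mat: "l < n \<Longrightarrow> det (reflection_mat n l) = -1"
  unfolding reflection_mat_def det_diag_block
  by (simp add: prod.remove[of _ l])

lemma rotation_mat_mult_reflection:
  "rotation_mat n t * reflection_mat n l = reflection_mat n l * rotation_mat n (t(l := - t l))"
  unfolding reflection_mat_def rotation_mat_def diag_block_mult
  by (intro arg_cong4[where f = "diag_block n"]) auto

lemma rotation_mat_cong:
  assumes "\<And>i. i < n \<Longrightarrow> cos (s i) = cos (t i) \<and> sin (s i) = sin (t i)"
  shows "rotation_mat n s = rotation_mat n t"
  unfolding rotation_mat_def by (rule eq_mat_blockI) (use assms in \<open>auto simp: diag_block_index\<close>)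

lemma special_orthogonal_group_simps:
  "A \<in> carrier (special_orthogonal_group N) \<longleftrightarrow>
    A \<in> carrier_mat N N \<and> transpose_mat A * A = 1\<^sub>m N \<and> det A = 1"
  "A \<otimes>\<^bsub>special_orthogonal_group N\<^esub> B = A * B"
  "\<one>\<^bsub>special_orthogonal_group N\<^esub> = 1\<^sub>m N"
  by (simp_all add: special_orthogonal_group_def)

lemma special_orthogonal_group_pow:
  assumes "A \<in> carrier (special_orthogonal_group N)"
  shows "A [^]\<^bsub>special_orthogonal_group N\<^esub> (l :: nat) = A ^\<^sub>m l"
proof -
  interpret group "special_orthogonal_group N" by (rule special_orthogonal_group_is_group)
  have "dim_row A = N" using assms by (auto simp: special_orthogonal_group_simps)
  then show ?thesis
    by (induction l) (simp_all add: special_orthogonal_group_simps)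
qed

lemma rotation_mat_special_orthogonal: "rotation_mat n t \<in> carrier (special_orthogonal_group (2 * n))"
  by (auto simp: special_orthogonal_group_simps rotation_mat_transpose rotation_mat_mult
      rotation_mat_eq_one det_rotation_mat)

lemma det_orthogonal:
  fixes Q :: "real mat"
  assumes "Q \<in> carrier_mat N N" "transpose_mat Q * Q = 1\<^sub>m N"
  shows "det Q = 1 \<or> det Q = -1"
proof -
  have "det Q * det Q = det (transpose_mat Q * Q)"
    using assms(1) by (simp add: det_mult[of _ N] det_transpose)
  then show ?thesis by (simp add: assms(2) square_eq_1_iff)
qed

section \<open>Counting classes by a system of representatives\<close>

lemma num_conjugacy_classes_exponent_eq_card:
  assumes "group G"
    and rep: "\<And>t. t \<in> T \<Longrightarrow> rep t \<in> carrier G" "\<And>t. t \<in> T \<Longrightarrow> rep t [^]\<^bsub>G\<^esub> m = \<one>\<^bsub>G\<^esub>"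
    and ex: "\<And>x. x \<in> carrier G \<Longrightarrow> x [^]\<^bsub>G\<^esub> m = \<one>\<^bsub>G\<^esub> \<Longrightarrow>
      \<exists>t\<in>T. \<exists>g\<in>carrier G. x \<otimes>\<^bsub>G\<^esub> g = g \<otimes>\<^bsub>G\<^esub> rep t"
    and unique: "\<And>s t g. s \<in> T \<Longrightarrow> t \<in> T \<Longrightarrow> g \<in> carrier G \<Longrightarrow>
      rep s \<otimes>\<^bsub>G\<^esub> g = g \<otimes>\<^bsub>G\<^esub> rep t \<Longrightarrow> s = t"
  shows "num_conjugacy_classes_exponent G m = card T"
proof -
  interpret group G by fact
  let ?\<phi> = "\<lambda>g. \<lambda>x \<in> carrier G. g \<otimes>\<^bsub>G\<^esub> x \<otimes>\<^bsub>G\<^esub> inv\<^bsub>G\<^esub> g"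
  interpret conj: group_action G "carrier G" ?\<phi> by (rule action_by_conjugation)
  let ?orb = "orbit G ?\<phi>"
  \<comment> \<open>Class membership becomes an intertwining relation, so the matrix computations
    never meet the group inverse.\<close>
  have mem_orbit: "y \<in> ?orb x \<longleftrightarrow> y \<in> carrier G \<and> (\<exists>g\<in>carrier G. y \<otimes>\<^bsub>G\<^esub> g = g \<otimes>\<^bsub>G\<^esub> x)"
    if "x \<in> carrier G" for x y
  proof -
    have "y = g \<otimes>\<^bsub>G\<^esub> x \<otimes>\<^bsub>G\<^esub> inv\<^bsub>G\<^esub> g \<longleftrightarrow> y \<in> carrier G \<and> y \<otimes>\<^bsub>G\<^esub> g = g \<otimes>\<^bsub>G\<^esub> x"
      if "g \<in> carrier G" for g
      using that \<open>x \<in> carrier G\<close>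
        inv_solve_right[of y "g \<otimes>\<^bsub>G\<^esub> x" g] by (cases "y \<in> carrier G") auto
    then show ?thesis using that unfolding orbit_def by (auto simp: restrict_def)
  qed
  \<comment> \<open>A counted class must lie wholly inside the solution set; since the equation is
    invariant under conjugation, one element decides.\<close>
  have pow_conj: "y [^]\<^bsub>G\<^esub> m = \<one>\<^bsub>G\<^esub>" if xy: "x \<in> carrier G" "y \<in> ?orb x" "x [^]\<^bsub>G\<^esub> m = \<one>\<^bsub>G\<^esub>" for x y
  proof -
    obtain g where g: "g \<in> carrier G" "y \<in> carrier G" "y \<otimes>\<^bsub>G\<^esub> g = g \<otimes>\<^bsub>G\<^esub> x"
      using xy mem_orbit by blast
    have "y [^]\<^bsub>G\<^esub> l \<otimes>\<^bsub>G\<^esub> g = g \<otimes>\<^bsub>G\<^esub> x [^]\<^bsub>G\<^esub> l" for l :: nat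
    proof (induction l)
      case (Suc l)
      have "y [^]\<^bsub>G\<^esub> Suc l \<otimes>\<^bsub>G\<^esub> g = y [^]\<^bsub>G\<^esub> l \<otimes>\<^bsub>G\<^esub> g \<otimes>\<^bsub>G\<^esub> x"
        using g xy(1) by (simp add: m_assoc)
      also have "\<dots> = g \<otimes>\<^bsub>G\<^esub> x [^]\<^bsub>G\<^esub> Suc l"
        unfolding Suc using g xy(1) by (simp add: m_assoc)
      finally show ?case .
    qed (use g in simp)
    from this[of m] show ?thesis using g xy(3) by (simp add: r_cancel_one')
  qed
  have "{C \<in> conjugacy_classes G. C \<subseteq> {x \<in> carrier G. x [^]\<^bsub>G\<^esub> m = \<one>\<^bsub>G\<^esub>}} = (\<lambda>t. ?orb (rep t)) ` T"
  proof (intro equalityI subsetI)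
    fix C assume "C \<in> {C \<in> conjugacy_classes G. C \<subseteq> {x \<in> carrier G. x [^]\<^bsub>G\<^esub> m = \<one>\<^bsub>G\<^esub>}}"
    then obtain x where x: "x \<in> carrier G" "C = ?orb x" and C: "C \<subseteq> {x \<in> carrier G. x [^]\<^bsub>G\<^esub> m = \<one>\<^bsub>G\<^esub>}"
      unfolding conjugacy_classes_def orbits_def by auto
    have "x [^]\<^bsub>G\<^esub> m = \<one>\<^bsub>G\<^esub>" using C conj.orbit_refl[OF x(1)] x(2) by auto
    then obtain t g where t: "t \<in> T" "g \<in> carrier G" "x \<otimes>\<^bsub>G\<^esub> g = g \<otimes>\<^bsub>G\<^esub> rep t"
      using ex[OF x(1)] by blast
    then have xo: "x \<in> ?orb (rep t)" using mem_orbit[OF rep(1)[OF t(1)]] x(1) by blast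
    then have xo': "rep t \<in> ?orb x" using conj.orbit_sym[OF rep(1)[OF t(1)] x(1)] by blast
    have "?orb x = ?orb (rep t)"
    proof (intro equalityI subsetI)
      fix y assume "y \<in> ?orb x"
      then show "y \<in> ?orb (rep t)"
        using conj.orbit_trans[OF rep(1)[OF t(1)] x(1) _ xo] mem_orbit[OF x(1)] by blast
    next
      fix y assume "y \<in> ?orb (rep t)"
      then show "y \<in> ?orb x"
        using conj.orbit_trans[OF x(1) rep(1)[OF t(1)] _ xo'] mem_orbit[OF rep(1)[OF t(1)]] by blast
    qed
    then show "C \<in> (\<lambda>t. ?orb (rep t)) ` T" using t(1) x(2) by blast
  next
    fix C assume "C \<in> (\<lambda>t. ?orb (rep t)) ` T"
    then obtain t where t: "t \<in> T" "C = ?orb (rep t)" by blast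
    have "C \<in> conjugacy_classes G"
      unfolding conjugacy_classes_def orbits_def using rep(1)[OF t(1)] t(2) by blast
    moreover have "C \<subseteq> {x \<in> carrier G. x [^]\<^bsub>G\<^esub> m = \<one>\<^bsub>G\<^esub>}"
      using pow_conj[OF rep(1)[OF t(1)] _ rep(2)[OF t(1)]] mem_orbit[OF rep(1)[OF t(1)]] t(2) by blast
    ultimately show "C \<in> {C \<in> conjugacy_classes G. C \<subseteq> {x \<in> carrier G. x [^]\<^bsub>G\<^esub> m = \<one>\<^bsub>G\<^esub>}}" by blast
  qed
  moreover have "inj_on (\<lambda>t. ?orb (rep t)) T"
  proof (rule inj_onI)
    fix s t assume st: "s \<in> T" "t \<in> T" "?orb (rep s) = ?orb (rep t)"
    have "rep s \<in> ?orb (rep t)" using conj.orbit_refl[OF rep(1)[OF st(1)]] st(3) by simp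
    then show "s = t" using mem_orbit[OF rep(1)[OF st(2)]] unique st(1,2) by blast
  qed
  ultimately show ?thesis
    unfolding num_conjugacy_classes_exponent_def by (simp add: card_image)
qed

section \<open>Representatives of the classes: existence and uniqueness\<close>

definition canonical_angles :: "nat \<Rightarrow> nat multiset \<Rightarrow> nat \<Rightarrow> real" where
  "canonical_angles k A i = angle k (sorted_list_of_multiset A ! i)"

text \<open>\<open>Inr A\<close> stands for the second of the two classes into which an \<open>O(2n)\<close>-class without
  eigenvalues \<open>1\<close> and \<open>-1\<close> splits.\<close>

fun class_rep :: "nat \<Rightarrow> nat \<Rightarrow> nat multiset + nat multiset \<Rightarrow> real mat" where
  "class_rep n k (Inl A) = rotation_mat n (canonical_angles k A)"
| "class_rep n k (Inr A) = rotation_mat n ((canonical_angles k A)(0 := - canonical_angles k A 0))"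

lemma length_sorted_list_of_multiset: "length (sorted_list_of_multiset A) = size A"
  by (metis mset_sorted_list_of_multiset size_mset)

lemma sorted_list_nth_mem: "i < size A \<Longrightarrow> sorted_list_of_multiset A ! i \<in># A"
  by (metis length_sorted_list_of_multiset nth_mem set_sorted_list_of_multiset)

lemma prod_sorted_list_nth: "(\<Prod>i<size A. f (sorted_list_of_multiset A ! i)) = (\<Prod>a\<in>#A. f a)"
proof -
  let ?xs = "sorted_list_of_multiset A"
  have "(\<Prod>a\<in>#A. f a) = (\<Prod>a\<in>#mset ?xs. f a)" by simp
  also have "\<dots> = prod_list (map f ?xs)" by (simp add: prod_mset_prod_list del: mset_sorted_list_of_multiset flip: mset_map)
  also have "\<dots> = (\<Prod>i<size A. f (?xs ! i))"
    unfolding prod.list_conv_set_nth by (simp add: length_sorted_list_of_multiset atLeast0LessThan)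
  finally show ?thesis ..
qed

lemma class_rep_pow:
  assumes "k > 0"
  shows "class_rep n k t ^\<^sub>m (2 * k) = 1\<^sub>m (2 * n)"
proof -
  have "cos (real (2 * k) * angle k j) = 1" for j
  proof -
    have "real (2 * k) * angle k j = 2 * real j * pi" using assms by (simp add: angle_def)
    then show ?thesis by (simp only: cos_2npi)
  qed
  then show ?thesis
    by (cases t) (auto simp: rotation_mat_pow canonical_angles_def intro!: rotation_mat_eq_one)
qed

lemma class_rep_exists:
  assumes k: "k > 0" and n: "n > 0" and M: "M \<in> carrier (special_orthogonal_group (2 * n))"
    and order: "M ^\<^sub>m (2 * k) = 1\<^sub>m (2 * n)"
  shows "\<exists>t \<in> multisets_of_size {0..k} n <+> multisets_of_size {1..<k} n.
    \<exists>g \<in> carrier (special_orthogonal_group (2 * n)). M * g = g * class_rep n k t"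
proof -
  have Mc: "M \<in> carrier_mat (2 * n) (2 * n)" "transpose_mat M * M = 1\<^sub>m (2 * n)" "det M = 1"
    using M by (auto simp: special_orthogonal_group_simps)
  interpret finite_order_isometry "2 * n" k M
    by unfold_locales (use Mc k order in auto)
  obtain u v j where uvj: "rotation_pairs n u v j" using exists_rotation_pairs[OF refl Mc(3) order.refl] by blast
  define A where "A = mset (map j [0..<n])"
  have size: "size A = n" by (simp add: A_def)
  have A: "A \<in> multisets_of_size {0..k} n"
    using uvj by (auto simp: multisets_of_size_def A_def rotation_pairs_def)
  let ?xs = "sorted_list_of_multiset A" and ?t = "canonical_angles k A"
  have "mset ?xs = mset (map j [0..<n])" by (simp add: A_def)
  \<comment> \<open>The planes were found in arbitrary order. Permuting \<open>u\<close> and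
    \<open>v\<close> by the same permutation aligns their angles with the sorted list.\<close>
  then obtain \<sigma> where \<sigma>: "\<sigma> permutes {..<n}" "permute_list \<sigma> (map j [0..<n]) = ?xs"
    by (rule mset_eq_permutation) simp
  have \<sigma>_less: "\<sigma> i < n" if "i < n" for i
    using permutes_in_image[OF \<sigma>(1), of i] that by simp
  have t: "?t i = angle k (j (\<sigma> i))" if "i < n" for i
    using permute_list_nth[of \<sigma> "map j [0..<n]" i] \<sigma> \<sigma>_less[OF that] that
    by (simp add: canonical_angles_def)
  define Q where "Q = pair_mat n (u \<circ> \<sigma>) (v \<circ> \<sigma>)"
  have on: "orthonormal_pairs (2 * n) n (u \<circ> \<sigma>) (v \<circ> \<sigma>)"
    using uvj permutes_inj[OF \<sigma>(1)] \<sigma>_less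
    by (auto simp: rotation_pairs_def orthonormal_pairs_def inj_eq)
  have MQ: "M * Q = Q * rotation_mat n ?t"
    unfolding Q_def rotation_mat_def
    by (rule pair_mat_conj[OF Mc(1) on])
      (use uvj \<sigma>_less in \<open>auto simp: rotation_pairs_def rotates_def t\<close>)
  have Q: "Q \<in> carrier_mat (2 * n) (2 * n)" "transpose_mat Q * Q = 1\<^sub>m (2 * n)"
    using pair_mat_orthogonal[OF on] by (auto simp: Q_def)
  show ?thesis
  proof (cases "det Q = 1")
    case True
    then have "Q \<in> carrier (special_orthogonal_group (2 * n))" using Q by (simp add: special_orthogonal_group_simps)
    with A MQ show ?thesis by (intro bexI[of _ "Inl A"] bexI[of _ Q]) auto
  next
    case False
    with det_orthogonal[OF Q] have det: "det Q = -1" by simp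
    have reflect: "Q * reflection_mat n l \<in> carrier (special_orthogonal_group (2 * n))"
      "M * (Q * reflection_mat n l) = Q * reflection_mat n l * rotation_mat n (?t(l := - ?t l))"
      if l: "l < n" for l
    proof -
      let ?F = "reflection_mat n l"
      have assoc: "B * C * D = B * (C * D)"
        if "B \<in> carrier_mat (2*n) (2*n)" "C \<in> carrier_mat (2*n) (2*n)" "D \<in> carrier_mat (2*n) (2*n)"
        for B C D :: "real mat"
        using that by (rule assoc_mult_mat)
      have "transpose_mat (Q * ?F) * (Q * ?F) = transpose_mat ?F * (transpose_mat Q * Q) * ?F"
        using Q(1) by (simp add: transpose_mult[of _ "2*n" "2*n" _ "2*n"] assoc)
      moreover have "transpose_mat ?F * 1\<^sub>m (2 * n) = transpose_mat ?F"
        by (rule right_mult_one_mat[OF transpose_carrier_mat[THEN iffD2, OF reflection_mat_carrier]])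
      ultimately show "Q * ?F \<in> carrier (special_orthogonal_group (2 * n))"
        using Q det l
        by (simp add: special_orthogonal_group_simps det_mult[of _ "2*n"] det_reflection_mat
            reflection_mat_orthogonal)
      have "M * (Q * ?F) = Q * (rotation_mat n ?t * ?F)"
        using Q(1) Mc(1) by (simp add: MQ assoc flip: assoc[of M Q])
      then show "M * (Q * ?F) = Q * ?F * rotation_mat n (?t(l := - ?t l))"
        using Q(1) by (simp add: rotation_mat_mult_reflection assoc)
    qed
    show ?thesis
    proof (cases "set_mset A \<subseteq> {1..<k}")
      case True
      \<comment> \<open>The reversal is made in plane 0, the one whose angle
        \<open>class_rep\<close> negates for \<open>Inr\<close>; it exists because
        \<open>n > 0\<close>.\<close>
      then have "A \<in> multisets_of_size {1..<k} n" using size by (simp add: multisets_of_size_def)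
      with reflect[OF n] show ?thesis
        by (intro bexI[of _ "Inr A"] bexI[of _ "Q * reflection_mat n 0"]) auto
    next
      case False
      then obtain a where a: "a \<in># A" "a \<notin> {1..<k}" by blast
      with A have "a = 0 \<or> a = k" by (force simp: multisets_of_size_def)
      then have sin_a: "sin (angle k a) = 0" using k by (auto simp: angle_def)
      from a(1) have "a \<in> set ?xs" by simp
      then obtain l where l: "l < n" "?xs ! l = a"
        unfolding in_set_conv_nth length_sorted_list_of_multiset size by blast
      \<comment> \<open>Negating an angle \<open>0\<close> or \<open>pi\<close> changes neither its
        cosine nor its sine, so a reversal in that plane leaves the representative
        unchanged.\<close>
      have "rotation_mat n (?t(l := - ?t l)) = class_rep n k (Inl A)"
        unfolding class_rep.simps
        by (rule rotation_mat_cong) (use l sin_a in \<open>auto simp: canonical_angles_def\<close>)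
      with reflect[OF l(1)] A show ?thesis
        by (intro bexI[of _ "Inl A"] bexI[of _ "Q * reflection_mat n l"]) auto
    qed
  qed
qed

lemma sin_canonical_angles_pos:
  assumes "B \<in> multisets_of_size {1..<k} n" "i < n"
  shows "sin (canonical_angles k B i) > 0"
proof -
  have "sorted_list_of_multiset B ! i \<in> {1..<k}"
    using assms sorted_list_nth_mem[of i B] by (auto simp: multisets_of_size_def)
  then show ?thesis
    unfolding canonical_angles_def angle_def by (intro sin_gt_zero) (auto simp: field_simps)
qed

text \<open>Composing such a \<open>g\<close> with the reflection gives a matrix of determinant -1
  that commutes with the unreflected rotation, against the sign of determinants in its
  centralizer.\<close>

lemma not_intertwined_with_reflected:
  assumes n: "n > 0" and s: "\<And>i. i < n \<Longrightarrow> sin (t i) > 0"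
    and g: "g \<in> carrier (special_orthogonal_group (2 * n))"
  shows "rotation_mat n t * g \<noteq> g * rotation_mat n (t(0 := - t 0))"
    and "rotation_mat n (t(0 := - t 0)) * g \<noteq> g * rotation_mat n t"
proof -
  let ?F = "reflection_mat n 0" and ?R = "rotation_mat n t" and ?R' = "rotation_mat n (t(0 := - t 0))"
  have g: "g \<in> carrier_mat (2 * n) (2 * n)" "det g = 1" using g by (auto simp: special_orthogonal_group_simps)
  have assoc: "B * C * D = B * (C * D)"
    if "B \<in> carrier_mat (2*n) (2*n)" "C \<in> carrier_mat (2*n) (2*n)" "D \<in> carrier_mat (2*n) (2*n)"
    for B C D :: "real mat"
    using that by (rule assoc_mult_mat)
  have RF: "?R * ?F = ?F * ?R'" by (rule rotation_mat_mult_reflection)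
  have R'F: "?R' * ?F = ?F * ?R"
    using rotation_mat_mult_reflection[of n "t(0 := - t 0)" 0] by simp
  show "?R * g \<noteq> g * ?R'"
  proof
    assume eq: "?R * g = g * ?R'"
    have "(g * ?F) * ?R = g * (?R' * ?F)" using g by (simp add: assoc R'F)
    also have "\<dots> = (g * ?R') * ?F" using g by (simp add: assoc)
    also have "\<dots> = ?R * (g * ?F)" unfolding eq[symmetric] using g by (simp add: assoc)
    finally have "det (g * ?F) \<ge> 0"
      by (rule det_centralizer_rotation_mat_nonneg[OF mult_carrier_mat[OF g(1) reflection_mat_carrier] _ s])
    then show False using g n by (simp add: det_mult[of _ "2 * n"] det_reflection_mat)
  qed
  show "?R' * g \<noteq> g * ?R"
  proof
    assume eq: "?R' * g = g * ?R"
    have "(?F * g) * ?R = ?F * (?R' * g)" unfolding eq using g by (simp add: assoc)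
    also have "\<dots> = (?F * ?R') * g" using g by (simp add: assoc)
    also have "\<dots> = ?R * (?F * g)" unfolding RF[symmetric] using g by (simp add: assoc)
    finally have "det (?F * g) \<ge> 0"
      by (rule det_centralizer_rotation_mat_nonneg[OF mult_carrier_mat[OF reflection_mat_carrier g(1)] _ s])
    then show False using g n by (simp add: det_mult[of _ "2 * n"] det_reflection_mat)
  qed
qed

text \<open>\<open>ms\<close> forgets the summand. The characteristic polynomial yields
  \<open>ms s = ms t\<close>, which leaves only \<open>Inl A\<close> against \<open>Inr A\<close>;
  there all sines are positive and the determinant on the centralizer decides.\<close>

lemma class_rep_unique:
  assumes k: "k > 0" and n: "n > 0"
    and st: "s \<in> multisets_of_size {0..k} n <+> multisets_of_size {1..<k} n"
      "t \<in> multisets_of_size {0..k} n <+> multisets_of_size {1..<k} n"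
    and g: "g \<in> carrier (special_orthogonal_group (2 * n))"
    and eq: "class_rep n k s * g = g * class_rep n k t"
  shows "s = t"
proof -
  define ms where "ms = case_sum id (id :: nat multiset \<Rightarrow> nat multiset)"
  have ms: "ms s \<in> multisets_of_size {0..k} n"
    if "s \<in> multisets_of_size {0..k} n <+> multisets_of_size {1..<k} n" for s
    using that by (auto simp: ms_def multisets_of_size_def)
  have "\<exists>a. class_rep n k s = rotation_mat n a \<and>
      (\<forall>x. (\<Prod>i<n. x\<^sup>2 - 2 * cos (a i) * x + 1) = (\<Prod>a\<in>#ms s. x\<^sup>2 - 2 * cos (angle k a) * x + 1))"
    if "size (ms s) = n" for s
  proof -
    have *: "(\<Prod>i<n. x\<^sup>2 - 2 * cos (canonical_angles k (ms s) i) * x + 1) =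
        (\<Prod>a\<in>#ms s. x\<^sup>2 - 2 * cos (angle k a) * x + 1)" for x
      using prod_sorted_list_nth[of "\<lambda>a. x\<^sup>2 - 2 * cos (angle k a) * x + 1" "ms s"]
      unfolding canonical_angles_def that by simp
    have **: "cos (((canonical_angles k A)(0 := - canonical_angles k A 0)) i) = cos (canonical_angles k A i)" for i A
      by simp
    show ?thesis
    proof (cases s)
      case (Inl A)
      then show ?thesis using * by (auto simp: ms_def)
    next
      case (Inr A)
      with * have "(\<Prod>i<n. x\<^sup>2 - 2 * cos (((canonical_angles k A)(0 := - canonical_angles k A 0)) i) * x + 1) =
          (\<Prod>a\<in>#ms s. x\<^sup>2 - 2 * cos (angle k a) * x + 1)" for x
        unfolding ** by (simp add: ms_def)
      then show ?thesis using Inr by (intro exI[of _ "(canonical_angles k A)(0 := - canonical_angles k A 0)"]) simp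
    qed
  qed note char = this
  have size: "size (ms s) = n" "size (ms t) = n" using ms[OF st(1)] ms[OF st(2)] by (auto simp: multisets_of_size_def)
  obtain a b where a: "class_rep n k s = rotation_mat n a"
      "\<And>x. (\<Prod>i<n. x\<^sup>2 - 2 * cos (a i) * x + 1) = (\<Prod>a\<in>#ms s. x\<^sup>2 - 2 * cos (angle k a) * x + 1)"
    and b: "class_rep n k t = rotation_mat n b"
      "\<And>x. (\<Prod>i<n. x\<^sup>2 - 2 * cos (b i) * x + 1) = (\<Prod>a\<in>#ms t. x\<^sup>2 - 2 * cos (angle k a) * x + 1)"
    using char[OF size(1)] char[OF size(2)] by blast
  have "(\<Prod>a\<in>#ms s. x\<^sup>2 - 2 * cos (angle k a) * x + 1) = (\<Prod>a\<in>#ms t. x\<^sup>2 - 2 * cos (angle k a) * x + 1)" for x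
    using rotation_mats_intertwined_imp[of g n a b x] g eq a b
    by (simp add: special_orthogonal_group_simps)
  then have "image_mset (\<lambda>j. cos (angle k j)) (ms s) = image_mset (\<lambda>j. cos (angle k j)) (ms t)"
    using size by (intro image_mset_eq_of_reciprocal_products) auto
  then have "ms s = ms t"
    using ms[OF st(1)] ms[OF st(2)]
    by (intro image_mset_inj_onD[OF _ cos_angle_inj[OF k]]) (auto simp: multisets_of_size_def)
  moreover have False if "s = Inl A" "t = Inr A" for A
    using not_intertwined_with_reflected(1)[OF n _ g, of "canonical_angles k A"]
      sin_canonical_angles_pos[of A k n] st eq that by auto
  moreover have False if "s = Inr A" "t = Inl A" for A
    using not_intertwined_with_reflected(2)[OF n _ g, of "canonical_angles k A"]
      sin_canonical_angles_pos[of A k n] st eq that by auto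
  ultimately show ?thesis by (cases s; cases t) (auto simp: ms_def)
qed

theorem theorem18:
  fixes n m :: nat
  assumes "n > 0" and "m > 0" and "even m"
  shows "num_conjugacy_classes_exponent (special_orthogonal_group (2 * n)) m =
    binomial_int (n + m div 2) (int (m div 2)) +
    binomial_int (n + m div 2 - 2) (int (m div 2) - 2)"
proof -
  define k where "k = m div 2"
  have m: "m = 2 * k" and k: "k > 0" using assms by (auto simp: k_def)
  let ?G = "special_orthogonal_group (2 * n)"
  let ?T = "multisets_of_size {0..k} n <+> multisets_of_size {1..<k} n"
  have rep: "class_rep n k t \<in> carrier ?G" for t
    by (cases t) (auto intro: rotation_mat_special_orthogonal)
  have "num_conjugacy_classes_exponent ?G m = card ?T"
  proof (rule num_conjugacy_classes_exponent_eq_card)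
    show "group ?G" by (rule special_orthogonal_group_is_group)
    show "class_rep n k t [^]\<^bsub>?G\<^esub> m = \<one>\<^bsub>?G\<^esub>" for t
      unfolding special_orthogonal_group_pow[OF rep] m
      by (simp add: class_rep_pow[OF k] special_orthogonal_group_simps)
    show "\<exists>t\<in>?T. \<exists>g\<in>carrier ?G. x \<otimes>\<^bsub>?G\<^esub> g = g \<otimes>\<^bsub>?G\<^esub> class_rep n k t"
      if "x \<in> carrier ?G" "x [^]\<^bsub>?G\<^esub> m = \<one>\<^bsub>?G\<^esub>" for x
      using class_rep_exists[OF k assms(1) that(1)] that(2)
      unfolding special_orthogonal_group_pow[OF that(1)] m by (simp add: special_orthogonal_group_simps(2,3))
    show "s = t" if "s \<in> ?T" "t \<in> ?T" "g \<in> carrier ?G"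
      "class_rep n k s \<otimes>\<^bsub>?G\<^esub> g = g \<otimes>\<^bsub>?G\<^esub> class_rep n k t" for s t g
      using class_rep_unique[OF k assms(1) that(1-3)] that(4) by (simp add: special_orthogonal_group_simps(2))
  qed (rule rep)
  also have "\<dots> = card (multisets_of_size {0..k} n) + card (multisets_of_size {1..<k} n)"
    by (intro card_Plus) auto
  \<comment> \<open>Multisets are counted with lower index \<open>n\<close>; symmetry turns it into
    \<open>k\<close>.\<close>
  also have "card (multisets_of_size {0..k} n) = binomial_int (n + k) (int k)"
    using binomial_symmetric[of n "n + k"] by (simp add: card_multisets_of_size binomial_int_def add.commute)
  also have "card (multisets_of_size {1..<k} n) = binomial_int (n + k - 2) (int k - 2)"
  proof (cases "k \<ge> 2")
    case True
    then have "nat (int k - 2) = k - 2" "n + k - 2 - n = k - 2" "k - 1 + n - 1 = n + k - 2" by auto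
    then show ?thesis
      using True binomial_symmetric[of n "n + k - 2"] by (simp add: card_multisets_of_size binomial_int_def)
  next
    \<comment> \<open>Here \<open>k = 1\<close>: the interval is empty, so it carries no multiset of
      positive size, in agreement with the value 0 at lower index -1.\<close>
    case False
    with assms(1) k show ?thesis by (simp add: binomial_int_def)
  qed
  finally show ?thesis by (simp add: k_def)
qed

end
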